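(* Let $\Lambda$ be an index set together with a finite subset $\Upsilon\subset\Lambda$, let $B$ and $\{A_\lambda\}_{\lambda\in\Lambda}$ be any groups, and let $\{B\curvearrowright I_\lambda\}_{\lambda\in\Lambda}$ be a collection of transitive actions with finite stabilizers. Let $U\in\mathcal{WR}_0(\{A_\lambda\}_{\lambda\in\Lambda},\{B\curvearrowright I_\lambda\}_{\lambda\in\Lambda})$. Suppose that for every $\lambda\in\Upsilon$, one of the following conditions holds: (a) $A_\lambda\cong\mathbb{Z}$; (b) $A_\lambda$ is abelian and the action $B\curvearrowright I_\lambda$ is regular. Then $U$ admits an epimorphism onto a central extension $Q$ of the form $$1\to\bigoplus_{\lambda\in\Upsilon}A_\lambda\to Q\to W\to1,$$ where $W\in\mathcal{WR}_0(\{A_\lambda\}_{\lambda\in\Lambda\setminus\Upsilon},\{B\curvearrowright I_\lambda\}_{\lambda\in\Lambda\setminus\Upsilon})$. Moreover, the associated 2-cocycle of this extension may be chosen to be trivial on the base $\bigoplus_{\lambda\in\Lambda\setminus\Upsilon}A_\lambda^{(I_\lambda)}$ of $W$.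
   Context: Generalized wreath-like products: let $B$ be a group, $\Lambda$ an index set, and for every $\lambda\in\Lambda$ let $A_\lambda$ be a group and $B\curvearrowright I_\lambda$ an action on a set. $\mathcal{WR}(\{A_\lambda\}_{\lambda\in\Lambda},\{B\curvearrowright I_\lambda\}_{\lambda\in\Lambda})$ is the collection of groups $W$ fitting in a short exact sequence $1\to\bigoplus_{\lambda\in\Lambda}\big(\bigoplus_{i\in I_\lambda}A_{\lambda,i}\big)\to W\overset{\varepsilon}{\to}B\to1$ with $A_{\lambda,i}\cong A_\lambda$ for all $\lambda\in\Lambda$, $i\in I_\lambda$, and $wA_{\lambda,i}w^{-1}=A_{\lambda,\varepsilon(w)i}$ for all $w\in W$, $\lambda\in\Lambda$, $i\in I_\lambda$. The normal subgroup $\bigoplus_{\lambda}\bigoplus_{i\in I_\lambda}A_{\lambda,i}=\bigoplus_\lambda A_\lambda^{(I_\lambda)}$ is the base of $W$ and $\varepsilon$ is the canonical homomorphism. Untwisted: for such $W$, let $P_{\lambda,i}=\varepsilon^{-1}(\mathrm{Stab}_B(i))$ for $i\in I_\lambda$. $W$ is untwisted if $P_{\lambda,i}$ is contained in the centralizer $C_W(A_{\lambda,i})$ for all $\lambda\in\Lambda$ and $i\in I_\lambda$. The subset of untwisted generalized wreath-like products is denoted $\mathcal{WR}_0(\{A_\lambda\}_{\lambda\in\Lambda},\{B\curvearrowright I_\lambda\}_{\lambda\in\Lambda})$. An action is regular if it is free and transitive. For a central extension $1\to C\to Q\to W\to1$ and a set-theoretic section $\sigma\colon W\to Q$, the associated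 2-cocycle $c\colon W\times W\to C$ is defined by $\sigma(g)\sigma(h)=c(g,h)\sigma(gh)$; it is trivial on a subgroup $K\leqslant W$ if $c(g,h)=1$ for all $g,h\in K$. Choosing the 2-cocycle means choosing the section $\sigma$. *)

theory Defs
  imports "HOL-Algebra.Algebra"
begin

section \<open>Actions\<close>

text \<open>
  The library's \<^locale>\<open>transitive_action\<close> also holds for the action on the empty set;
  a transitive action is required here to have exactly one orbit.
\<close>

locale nonempty_transitive_action = transitive_action +
  assumes nonempty: "E \<noteq> {}"

locale regular_action = nonempty_transitive_action +
  assumes free: "\<lbrakk>g \<in> carrier G; x \<in> E; \<phi> g x = x\<rbrakk> \<Longrightarrow> g = \<one>"


section \<open>Extensions, sections and 2-cocycles\<close>

definition centralizer :: "('a, 'm) monoid_scheme \<Rightarrow> 'a set \<Rightarrow> 'a set"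
  where "centralizer G S = {g \<in> carrier G. \<forall>s\<in>S. g \<otimes>\<^bsub>G\<^esub> s = s \<otimes>\<^bsub>G\<^esub> g}"

text \<open>
  Exactness of \<open>1 \<rightarrow> N \<rightarrow> G \<rightarrow> H \<rightarrow> 1\<close> with maps \<open>\<iota>\<close> and \<open>p\<close>. The library's
  \<open>short_exact_sequence\<close> forces the three groups to have the same element type.
\<close>

definition group_extension ::
  "'n monoid \<Rightarrow> 'g monoid \<Rightarrow> 'h monoid \<Rightarrow> ('n \<Rightarrow> 'g) \<Rightarrow> ('g \<Rightarrow> 'h) \<Rightarrow> bool"
  where "group_extension N G H \<iota> p \<longleftrightarrow>
    group N \<and> group G \<and> group H \<and> \<iota> \<in> mon N G \<and> p \<in> epi G H \<and>
    \<iota> ` carrier N = kernel G H p"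

definition central_extension ::
  "'n monoid \<Rightarrow> 'g monoid \<Rightarrow> 'h monoid \<Rightarrow> ('n \<Rightarrow> 'g) \<Rightarrow> ('g \<Rightarrow> 'h) \<Rightarrow> bool"
  where "central_extension N G H \<iota> p \<longleftrightarrow>
    group_extension N G H \<iota> p \<and> \<iota> ` carrier N \<subseteq> centralizer G (carrier G)"

definition set_section :: "'g monoid \<Rightarrow> 'h monoid \<Rightarrow> ('g \<Rightarrow> 'h) \<Rightarrow> ('h \<Rightarrow> 'g) \<Rightarrow> bool"
  where "set_section G H p \<sigma> \<longleftrightarrow> (\<forall>h\<in>carrier H. \<sigma> h \<in> carrier G \<and> p (\<sigma> h) = h)"

definition extension_cocycle ::
  "'n monoid \<Rightarrow> 'g monoid \<Rightarrow> 'h monoid \<Rightarrow> ('n \<Rightarrow> 'g) \<Rightarrow> ('h \<Rightarrow> 'g) \<Rightarrow> 'h \<Rightarrow> 'h \<Rightarrow> 'n"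
  where "extension_cocycle N G H \<iota> \<sigma> g h =
    (THE c. c \<in> carrier N \<and> \<sigma> g \<otimes>\<^bsub>G\<^esub> \<sigma> h = \<iota> c \<otimes>\<^bsub>G\<^esub> \<sigma> (g \<otimes>\<^bsub>H\<^esub> h))"

lemma extension_cocycle_unique:
  assumes ext: "group_extension N G H \<iota> p" and sec: "set_section G H p \<sigma>"
    and g: "g \<in> carrier H" and h: "h \<in> carrier H"
  shows "\<exists>!c. c \<in> carrier N \<and> \<sigma> g \<otimes>\<^bsub>G\<^esub> \<sigma> h = \<iota> c \<otimes>\<^bsub>G\<^esub> \<sigma> (g \<otimes>\<^bsub>H\<^esub> h)"
proof -
  interpret G: group G using ext by (simp add: group_extension_def)
  interpret H: group H using ext by (simp add: group_extension_def)
  have \<iota>: "\<iota> \<in> carrier N \<rightarrow> carrier G" "inj_on \<iota> (carrier N)"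
    and ker: "\<iota> ` carrier N = kernel G H p" and p: "p \<in> hom G H"
    using ext by (auto simp: group_extension_def mon_def epi_def hom_def)
  interpret p: group_hom G H p
    by unfold_locales (rule p)
  have gh: "g \<otimes>\<^bsub>H\<^esub> h \<in> carrier H" using g h by simp
  have \<sigma>: "\<sigma> x \<in> carrier G" "p (\<sigma> x) = x" if "x \<in> carrier H" for x
    using sec that by (auto simp: set_section_def)
  let ?d = "\<sigma> g \<otimes>\<^bsub>G\<^esub> \<sigma> h \<otimes>\<^bsub>G\<^esub> inv\<^bsub>G\<^esub> \<sigma> (g \<otimes>\<^bsub>H\<^esub> h)"
  have iff: "\<sigma> g \<otimes>\<^bsub>G\<^esub> \<sigma> h = x \<otimes>\<^bsub>G\<^esub> \<sigma> (g \<otimes>\<^bsub>H\<^esub> h) \<longleftrightarrow> x = ?d" if "x \<in> carrier G" for x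
    using that \<sigma>(1)[OF g] \<sigma>(1)[OF h] \<sigma>(1)[OF gh] by (metis G.inv_solve_right G.m_closed)
  have "?d \<in> kernel G H p"
    using \<sigma>[OF g] \<sigma>[OF h] \<sigma>[OF gh] g h by (simp add: kernel_def)
  then obtain c where c: "c \<in> carrier N" "\<iota> c = ?d" using ker by (metis imageE)
  show ?thesis
  proof (rule ex1I)
    show "c \<in> carrier N \<and> \<sigma> g \<otimes>\<^bsub>G\<^esub> \<sigma> h = \<iota> c \<otimes>\<^bsub>G\<^esub> \<sigma> (g \<otimes>\<^bsub>H\<^esub> h)"
      using c iff \<iota> by blast
  next
    fix c' assume "c' \<in> carrier N \<and> \<sigma> g \<otimes>\<^bsub>G\<^esub> \<sigma> h = \<iota> c' \<otimes>\<^bsub>G\<^esub> \<sigma> (g \<otimes>\<^bsub>H\<^esub> h)"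
    then show "c' = c" using c iff \<iota> by (metis PiE inj_onD)
  qed
qed

definition cocycle_trivial_on :: "'n monoid \<Rightarrow> ('h \<Rightarrow> 'h \<Rightarrow> 'n) \<Rightarrow> 'h set \<Rightarrow> bool"
  where "cocycle_trivial_on N c K \<longleftrightarrow> (\<forall>g\<in>K. \<forall>h\<in>K. c g h = \<one>\<^bsub>N\<^esub>)"


section \<open>Generalized wreath-like products\<close>

definition double_sum_group ::
  "'l set \<Rightarrow> ('l \<Rightarrow> 'i set) \<Rightarrow> ('l \<Rightarrow> 'i \<Rightarrow> 'c monoid) \<Rightarrow> ('l \<Rightarrow> 'i \<Rightarrow> 'c) monoid"
  where "double_sum_group \<Lambda> I C = sum_group \<Lambda> (\<lambda>l. sum_group (I l) (C l))"

definition wreath_base ::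
  "'l set \<Rightarrow> ('l \<Rightarrow> 'i set) \<Rightarrow> ('l \<Rightarrow> 'i \<Rightarrow> 'c monoid) \<Rightarrow> (('l \<Rightarrow> 'i \<Rightarrow> 'c) \<Rightarrow> 'w) \<Rightarrow> 'w set"
  where "wreath_base \<Lambda> I C \<iota> = \<iota> ` carrier (double_sum_group \<Lambda> I C)"

text \<open>The summand with index \<open>(l, i)\<close>, viewed as a subgroup of \<open>W\<close> through \<open>\<iota>\<close>.\<close>

definition wreath_summand ::
  "'l set \<Rightarrow> ('l \<Rightarrow> 'i set) \<Rightarrow> ('l \<Rightarrow> 'i \<Rightarrow> 'c monoid) \<Rightarrow> (('l \<Rightarrow> 'i \<Rightarrow> 'c) \<Rightarrow> 'w) \<Rightarrow> 'l \<Rightarrow> 'i \<Rightarrow> 'w set"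
  where "wreath_summand \<Lambda> I C \<iota> l i =
    \<iota> ` {x \<in> carrier (double_sum_group \<Lambda> I C).
          \<forall>m\<in>\<Lambda>. \<forall>j\<in>I m. (m, j) \<noteq> (l, i) \<longrightarrow> x m j = \<one>\<^bsub>C m j\<^esub>}"

text \<open>
  \<open>W\<close> is a generalized wreath-like product of the groups \<open>A l\<close> along the actions
  \<open>\<phi> l\<close> of \<open>B\<close> on \<open>I l\<close> (for \<open>l \<in> \<Lambda>\<close>), as witnessed by the groups \<open>C l i\<close> isomorphic to \<open>A l\<close>
  and the maps \<open>\<iota>\<close> and \<open>\<epsilon>\<close> of the short exact sequence. Nothing is assumed about indices
  outside \<open>\<Lambda>\<close> and \<open>I l\<close>.
\<close>

locale wreath_like_product =
  fixes \<Lambda> :: "'l set"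
    and A :: "'l \<Rightarrow> 'a monoid"
    and B :: "'b monoid"
    and I :: "'l \<Rightarrow> 'i set"
    and \<phi> :: "'l \<Rightarrow> 'b \<Rightarrow> 'i \<Rightarrow> 'i"
    and W :: "'w monoid"
    and C :: "'l \<Rightarrow> 'i \<Rightarrow> 'c monoid"
    and \<iota> :: "('l \<Rightarrow> 'i \<Rightarrow> 'c) \<Rightarrow> 'w"
    and \<epsilon> :: "'w \<Rightarrow> 'b"
  assumes group_A: "l \<in> \<Lambda> \<Longrightarrow> group (A l)"
    and action: "l \<in> \<Lambda> \<Longrightarrow> group_action B (I l) (\<phi> l)"
    and group_C: "\<lbrakk>l \<in> \<Lambda>; i \<in> I l\<rbrakk> \<Longrightarrow> group (C l i)"
    and iso_C: "\<lbrakk>l \<in> \<Lambda>; i \<in> I l\<rbrakk> \<Longrightarrow> C l i \<cong> A l"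
    and extension: "group_extension (double_sum_group \<Lambda> I C) W B \<iota> \<epsilon>"
    and conjugation: "\<lbrakk>w \<in> carrier W; l \<in> \<Lambda>; i \<in> I l\<rbrakk> \<Longrightarrow>
      w <#\<^bsub>W\<^esub> wreath_summand \<Lambda> I C \<iota> l i #>\<^bsub>W\<^esub> inv\<^bsub>W\<^esub> w
        = wreath_summand \<Lambda> I C \<iota> l (\<phi> l (\<epsilon> w) i)"

locale untwisted_wreath_like_product = wreath_like_product +
  assumes untwisted: "\<lbrakk>l \<in> \<Lambda>; i \<in> I l\<rbrakk> \<Longrightarrow>
    {w \<in> carrier W. \<epsilon> w \<in> stabilizer B (\<phi> l) i} \<subseteq> centralizer W (wreath_summand \<Lambda> I C \<iota> l i)"

end

theory Submission
  imports Defs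
begin

text \<open>
  Write \<open>A\<^sub>l\<^sub>,\<^sub>i\<close> for the summands of the base of \<open>U\<close>. The kernel of \<open>\<epsilon>\<close> is the base, which fixes
  every index, so untwistedness makes the base centralize every summand: the base is abelian.

  Untwistedness also says that conjugation by an element fixing the index \<open>i\<close> is trivial on
  \<open>A\<^sub>l\<^sub>,\<^sub>i\<close>. As the action on \<open>I l\<close> is transitive, conjugating every \<open>A\<^sub>l\<^sub>,\<^sub>i\<close> to one fixed summand
  gives maps \<open>A\<^sub>l\<^sub>,\<^sub>i \<rightarrow> A l\<close> that do not depend on the conjugating elements, and so are compatible
  with conjugation by all of \<open>U\<close> (\<open>equivariant_maps\<close>). Summing them over \<open>I l\<close>
  (\<open>invariant_sum\<close>) and collecting the sums for all \<open>l \<in> \<Upsilon>\<close> (\<open>invariant_total\<close>) gives a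
  surjection \<open>s\<close> onto the direct sum of the \<open>A l\<close>, defined on the part \<open>M\<close> of the base over \<open>\<Upsilon>\<close>
  and invariant under conjugation.

  Let \<open>N\<close> be the kernel of \<open>s\<close>, and put \<open>Q = U/N\<close> and \<open>W = U/M\<close>. Invariance of \<open>s\<close> makes \<open>N\<close>
  normal and \<open>M/N\<close> central in \<open>Q\<close>, and \<open>s\<close> identifies \<open>M/N\<close> with the direct sum of the \<open>A l\<close>
  (\<open>central_extension_of_quotients\<close>). Dividing by \<open>M\<close> only removes the summands over \<open>\<Upsilon>\<close>, so \<open>W\<close>
  is an untwisted wreath-like product over \<open>\<Lambda> - \<Upsilon>\<close> (\<open>untwisted_quotient\<close>).

  The part \<open>L\<close> of the base over \<open>\<Lambda> - \<Upsilon>\<close> meets \<open>M\<close> trivially and maps onto the base of \<open>W\<close>. The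
  base of \<open>W\<close> therefore lifts to \<open>Q\<close> by a homomorphism through \<open>L\<close>, and a section extending this
  lift has a cocycle that is trivial on the base (\<open>section_trivial_on_complement\<close>).
\<close>

section \<open>Central extensions from invariant homomorphisms\<close>

lemma (in subgroup) rcos_eq_iff:
  assumes "group G" and "x \<in> carrier G" and "y \<in> carrier G"
  shows "H #> x = H #> y \<longleftrightarrow> x \<otimes> inv y \<in> H"
proof -
  interpret group G by fact
  have sub: "subgroup H G" by (rule subgroup_axioms)
  show ?thesis
  proof
    assume "H #> x = H #> y"
    then have "x \<in> H #> y" using rcos_self[OF assms(2) sub] by simp
    then show "x \<otimes> inv y \<in> H" using assms by (simp add: rcos_module)
  next
    assume "x \<otimes> inv y \<in> H"
    then have "x \<in> H #> y" using assms by (simp add: rcos_module)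
    then show "H #> x = H #> y" using repr_independence assms sub by metis
  qed
qed

lemma (in subgroup) inj_on_rcos_complement:
  assumes "group G" and "subgroup L G" and "L \<inter> H \<subseteq> {\<one>}"
  shows "inj_on (\<lambda>x. H #> x) L"
proof (rule inj_onI)
  interpret group G by fact
  interpret L: subgroup L G by fact
  fix x y assume xy: "x \<in> L" "y \<in> L" "H #> x = H #> y"
  then have "x \<otimes> inv y \<in> L \<inter> H" by (simp add: rcos_eq_iff[OF is_group])
  then have "x \<otimes> inv y = \<one>" using assms(3) by blast
  then show "x = y" using xy inv_equality[of x "inv y"] by simp
qed

text \<open>
  The situation behind the central extension: the values of \<open>s\<close> on the normal subgroup \<open>M\<close> do
  not change under conjugation by \<open>G\<close>, so modulo the kernel \<open>N\<close> of \<open>s\<close> every element of \<open>M\<close>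
  commutes with everything.
\<close>

locale invariant_hom = normal M G + Z: group Z
  for M and G :: "'g monoid" (structure) and Z :: "'z monoid" +
  fixes s :: "'g \<Rightarrow> 'z"
  assumes hom: "s \<in> hom (G\<lparr>carrier := M\<rparr>) Z"
    and onto: "s ` M = carrier Z"
    and invariant: "\<lbrakk>g \<in> carrier G; m \<in> M\<rbrakk> \<Longrightarrow> s (g \<otimes> m \<otimes> inv g) = s m"
begin

definition N :: "'g set"
  where "N = kernel (G\<lparr>carrier := M\<rparr>) Z s"

lemma s_mult: "\<lbrakk>m \<in> M; n \<in> M\<rbrakk> \<Longrightarrow> s (m \<otimes> n) = s m \<otimes>\<^bsub>Z\<^esub> s n"
  using hom_mult[OF hom] by simp

lemma s_closed: "m \<in> M \<Longrightarrow> s m \<in> carrier Z"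
  using onto by auto

lemma s_one: "s \<one> = \<one>\<^bsub>Z\<^esub>"
proof -
  have "s \<one> \<otimes>\<^bsub>Z\<^esub> s \<one> = s \<one>"
    using s_mult[of \<one> \<one>] by simp
  then show ?thesis using s_closed[OF subgroup.one_closed[OF subgroup_axioms]] by simp
qed

lemma s_inv: "m \<in> M \<Longrightarrow> s (inv m) = inv\<^bsub>Z\<^esub> s m"
  using s_mult[of "inv m" m] s_one s_closed by (intro Z.inv_equality[symmetric]) auto

lemma N_iff: "n \<in> N \<longleftrightarrow> n \<in> M \<and> s n = \<one>\<^bsub>Z\<^esub>"
  by (auto simp: N_def kernel_def)

lemma N_normal: "N \<lhd> G"
proof (rule normal_invI)
  show "subgroup N G"
    by (rule subgroup.intro) (auto simp: N_iff s_mult s_one s_inv)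
  show "x \<otimes> h \<otimes> inv x \<in> N" if "x \<in> carrier G" "h \<in> N" for x h
    using that inv_op_closed2 invariant by (simp add: N_iff)
qed

lemma N_rcos_eq_iff:
  "\<lbrakk>x \<in> carrier G; y \<in> carrier G\<rbrakk> \<Longrightarrow> N #> x = N #> y \<longleftrightarrow> x \<otimes> inv y \<in> N"
  using subgroup.rcos_eq_iff[OF normal_imp_subgroup[OF N_normal] is_group] .

lemma s_eq_iff_rcos_eq:
  "\<lbrakk>m \<in> M; n \<in> M\<rbrakk> \<Longrightarrow> s m = s n \<longleftrightarrow> N #> m = N #> n"
  by (simp add: N_rcos_eq_iff N_iff s_mult s_inv s_closed Z.inv_solve_right')

text \<open>
  The kernel of \<open>G/N \<rightarrow> G/M\<close> is \<open>M/N\<close>, which \<open>s\<close> identifies with \<open>Z\<close>. It is central because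
  \<open>s\<close> takes the value one on the commutators \<open>m (x m\<inverse> x\<inverse>)\<close>, and so these lie in \<open>N\<close>.
\<close>

lemma central_extension_of_quotients:
  "\<exists>j q. central_extension Z (G Mod N) (G Mod M) j q \<and>
     (\<forall>m\<in>M. j (s m) = N #> m) \<and> (\<forall>x\<in>carrier G. q (N #> x) = M #> x)"
proof -
  interpret N: normal N G by (rule N_normal)
  have "M #> x = M #> y" if "x \<in> carrier G" "y \<in> carrier G" "N #> x = N #> y" for x y
    using that rcos_eq_iff[OF is_group that(1,2)] by (simp add: N_rcos_eq_iff N_iff)
  then obtain q where q: "q \<in> hom (G Mod N) (G Mod M)"
    and q_rcos: "\<And>x. x \<in> carrier G \<Longrightarrow> q (N #> x) = M #> x"
    using FactGroup_universal[OF r_coset_hom_Mod N_normal] by blast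
  define j where "j z = N #> inv_into M s z" for z
  have j_s: "j (s m) = N #> m" if "m \<in> M" for m
    unfolding j_def using that s_eq_iff_rcos_eq[of "inv_into M s (s m)" m]
    by (simp add: inv_into_into f_inv_into_f)
  have "j \<in> hom Z (G Mod N)"
  proof (rule homI)
    fix x y assume "x \<in> carrier Z" "y \<in> carrier Z"
    then obtain m n where "m \<in> M" "x = s m" "n \<in> M" "y = s n"
      using onto by (metis imageE)
    then show "j x \<in> carrier (G Mod N)" "j (x \<otimes>\<^bsub>Z\<^esub> y) = j x \<otimes>\<^bsub>G Mod N\<^esub> j y"
      by (simp_all add: j_s carrier_FactGroup N.rcos_sum flip: s_mult)
  qed
  moreover have "inj_on j (carrier Z)"
  proof (rule inj_onI)
    fix x y assume "x \<in> carrier Z" "y \<in> carrier Z" "j x = j y"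
    moreover from this obtain m n where "m \<in> M" "x = s m" "n \<in> M" "y = s n"
      using onto by (metis imageE)
    ultimately show "x = y" by (simp add: j_s s_eq_iff_rcos_eq)
  qed
  ultimately have "j \<in> mon Z (G Mod N)" by (simp add: mon_def)
  moreover have "q \<in> epi (G Mod N) (G Mod M)"
    using q q_rcos by (simp add: epi_def carrier_FactGroup image_image)
  moreover have image_j: "j ` carrier Z = (\<lambda>m. N #> m) ` M"
    using j_s by (auto simp flip: onto)
  moreover have "(\<lambda>m. N #> m) ` M = kernel (G Mod N) (G Mod M) q"
  proof -
    have "M #> x = M \<longleftrightarrow> x \<in> M" if "x \<in> carrier G" for x
      using that coset_join1[OF _ that subgroup_axioms] coset_join2[OF that subgroup_axioms]
      by blast
    then have "q (N #> x) = M \<longleftrightarrow> x \<in> M" if "x \<in> carrier G" for x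
      using that by (simp add: q_rcos)
    then have "kernel (G Mod N) (G Mod M) q = (\<lambda>x. N #> x) ` {x \<in> carrier G. x \<in> M}"
      unfolding kernel_def carrier_FactGroup one_FactGroup by blast
    moreover have "{x \<in> carrier G. x \<in> M} = M" using subset by blast
    ultimately show ?thesis by simp
  qed
  ultimately have "group_extension Z (G Mod N) (G Mod M) j q"
    by (simp add: group_extension_def N.factorgroup_is_group factorgroup_is_group Z.is_group)
  moreover have "j ` carrier Z \<subseteq> centralizer (G Mod N) (carrier (G Mod N))"
  proof -
    have "N #> (m \<otimes> x) = N #> (x \<otimes> m)" if m: "m \<in> M" and x: "x \<in> carrier G" for m x
    proof -
      have "m \<otimes> x \<otimes> inv (x \<otimes> m) = m \<otimes> (x \<otimes> inv m \<otimes> inv x)"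
        using that by (simp add: inv_mult_group m_assoc)
      moreover have "m \<otimes> (x \<otimes> inv m \<otimes> inv x) \<in> N"
        using that inv_op_closed2[of x "inv m"] invariant[of x "inv m"]
        by (simp add: N_iff s_mult s_inv s_closed)
      ultimately show ?thesis using that by (simp add: N_rcos_eq_iff)
    qed
    then have "N #> m \<in> centralizer (G Mod N) (carrier (G Mod N))" if "m \<in> M" for m
      unfolding centralizer_def carrier_FactGroup mult_FactGroup
      using that by (auto simp only: N.rcos_sum mem_carrier)
    then show ?thesis unfolding image_j by blast
  qed
  ultimately have "central_extension Z (G Mod N) (G Mod M) j q"
    unfolding central_extension_def by (rule conjI)
  then show ?thesis using j_s q_rcos by (intro exI[of _ j] exI[of _ q]) simp
qed

text \<open>
  A subgroup \<open>L\<close> meeting \<open>M\<close> trivially embeds into both quotients. Over its image in \<open>G/M\<close> the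
  section sends the coset of \<open>x \<in> L\<close> to the coset \<open>N #> x\<close>, which is multiplicative there; the
  choice of lifts elsewhere is arbitrary.
\<close>

lemma section_trivial_on_complement:
  assumes ext: "group_extension Z (G Mod N) (G Mod M) j q"
    and q: "\<And>x. x \<in> carrier G \<Longrightarrow> q (N #> x) = M #> x"
    and L: "subgroup L G" and disj: "L \<inter> M \<subseteq> {\<one>}"
  shows "\<exists>\<sigma>. set_section (G Mod N) (G Mod M) q \<sigma> \<and>
    cocycle_trivial_on Z (extension_cocycle Z (G Mod N) (G Mod M) j \<sigma>) ((\<lambda>x. M #> x) ` L)"
proof -
  interpret N: normal N G by (rule N_normal)
  interpret L: subgroup L G by (rule L)
  \<comment> \<open>Over \<open>L\<close> the representative must be the one lying in \<open>L\<close>, for multiplicativity.\<close>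
  define R where "R a = (if a \<in> (\<lambda>x. M #> x) ` L then inv_into L (\<lambda>x. M #> x) a
    else inv_into (carrier G) (\<lambda>x. M #> x) a)" for a
  have "inj_on (\<lambda>x. M #> x) L"
    using is_group L disj by (rule inj_on_rcos_complement)
  then have R_L: "R (M #> x) = x" if "x \<in> L" for x
    using that by (simp add: R_def)
  have R: "R a \<in> carrier G \<and> M #> R a = a" if "a \<in> carrier (G Mod M)" for a
  proof (cases "a \<in> (\<lambda>x. M #> x) ` L")
    case True
    then show ?thesis using R_L by auto
  next
    case False
    moreover have "a \<in> (\<lambda>x. M #> x) ` carrier G"
      using that by (simp add: carrier_FactGroup)
    ultimately show ?thesis
      using inv_into_into[of a "\<lambda>x. M #> x" "carrier G"] f_inv_into_f[of a "\<lambda>x. M #> x" "carrier G"]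
      by (simp add: R_def)
  qed
  define \<sigma> where "\<sigma> a = N #> R a" for a
  have sec: "set_section (G Mod N) (G Mod M) q \<sigma>"
    using R q by (auto simp: set_section_def \<sigma>_def carrier_FactGroup)
  have one: "j \<one>\<^bsub>Z\<^esub> = N"
  proof -
    have "j \<in> hom Z (G Mod N)" "group (G Mod N)"
      using ext by (auto simp: group_extension_def mon_def)
    then show ?thesis using hom_one[of j Z "G Mod N"] by (simp add: Z.is_group)
  qed
  have "extension_cocycle Z (G Mod N) (G Mod M) j \<sigma> (M #> x) (M #> y) = \<one>\<^bsub>Z\<^esub>"
    if "x \<in> L" "y \<in> L" for x y
    unfolding extension_cocycle_def
  proof (rule the1_equality)
    show "\<exists>!c. c \<in> carrier Z \<and> \<sigma> (M #> x) \<otimes>\<^bsub>G Mod N\<^esub> \<sigma> (M #> y)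
        = j c \<otimes>\<^bsub>G Mod N\<^esub> \<sigma> ((M #> x) \<otimes>\<^bsub>G Mod M\<^esub> (M #> y))"
      using that by (intro extension_cocycle_unique[OF ext sec]) (auto simp: carrier_FactGroup)
    show "\<one>\<^bsub>Z\<^esub> \<in> carrier Z \<and> \<sigma> (M #> x) \<otimes>\<^bsub>G Mod N\<^esub> \<sigma> (M #> y)
        = j \<one>\<^bsub>Z\<^esub> \<otimes>\<^bsub>G Mod N\<^esub> \<sigma> ((M #> x) \<otimes>\<^bsub>G Mod M\<^esub> (M #> y))"
      using that by (simp add: \<sigma>_def one rcos_sum N.rcos_sum R_L N.rcosets_mult_eq rcosetsI N.subset)
  qed
  then show ?thesis using sec by (auto simp: cocycle_trivial_on_def)
qed

end

section \<open>Iterated direct sums\<close>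

locale group_family =
  fixes \<Lambda> :: "'l set"
    and I :: "'l \<Rightarrow> 'i set"
    and C :: "'l \<Rightarrow> 'i \<Rightarrow> 'c monoid"
  assumes group_C: "\<lbrakk>l \<in> \<Lambda>; i \<in> I l\<rbrakk> \<Longrightarrow> group (C l i)"
begin

abbreviation D :: "('l \<Rightarrow> 'i \<Rightarrow> 'c) monoid"
  where "D \<equiv> double_sum_group \<Lambda> I C"

definition support :: "('l \<Rightarrow> 'i \<Rightarrow> 'c) \<Rightarrow> ('l \<times> 'i) set"
  where "support x = {(l, i). l \<in> \<Lambda> \<and> i \<in> I l \<and> x l i \<noteq> \<one>\<^bsub>C l i\<^esub>}"

lemma group_sum_C: "l \<in> \<Lambda> \<Longrightarrow> group (sum_group (I l) (C l))"
  by (simp add: group_C)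

lemma group_D: "group D"
  unfolding double_sum_group_def by (intro sum_group group_sum_C)

text \<open>
  Puts the two nested finiteness conditions into one, on which induction over the support can run.
\<close>

lemma carrier_D:
  "carrier D = {x \<in> \<Pi>\<^sub>E l\<in>\<Lambda>. \<Pi>\<^sub>E i\<in>I l. carrier (C l i). finite (support x)}"
proof -
  have "x \<in> carrier D \<longleftrightarrow> finite (support x)"
    if x: "x \<in> (\<Pi>\<^sub>E l\<in>\<Lambda>. \<Pi>\<^sub>E i\<in>I l. carrier (C l i))" for x
  proof -
    let ?J = "{l \<in> \<Lambda>. x l \<noteq> (\<lambda>i\<in>I l. \<one>\<^bsub>C l i\<^esub>)}"
    have supp: "support x = Sigma ?J (\<lambda>l. {i \<in> I l. x l i \<noteq> \<one>\<^bsub>C l i\<^esub>})"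
      by (auto simp: support_def)
    have J: "?J = fst ` support x"
    proof (intro equalityI subsetI)
      fix l assume l: "l \<in> ?J"
      then have "x l \<in> extensional (I l)" using x by (auto simp: PiE_iff)
      then have "x l = (\<lambda>i\<in>I l. \<one>\<^bsub>C l i\<^esub>)" if "\<forall>i\<in>I l. x l i = \<one>\<^bsub>C l i\<^esub>"
        by (rule extensionalityI) (use that in auto)
      then obtain i where "i \<in> I l" "x l i \<noteq> \<one>\<^bsub>C l i\<^esub>"
        using l by auto
      then show "l \<in> fst ` support x" using l by (force simp: support_def)
    qed (auto simp: supp)
    have "x \<in> carrier D \<longleftrightarrow> (\<forall>l\<in>\<Lambda>. finite {i \<in> I l. x l i \<noteq> \<one>\<^bsub>C l i\<^esub>}) \<and> finite ?J"
      using x by (auto simp: double_sum_group_def carrier_sum_group group_sum_C group_C PiE_iff)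
    also have "\<dots> \<longleftrightarrow> finite (support x)"
    proof
      assume *: "finite (support x)"
      then have "finite {i \<in> I l. x l i \<noteq> \<one>\<^bsub>C l i\<^esub>}" if "l \<in> \<Lambda>" for l
        by (rule finite_surj[of _ _ snd]) (use that in \<open>force simp: support_def\<close>)
      then show "(\<forall>l\<in>\<Lambda>. finite {i \<in> I l. x l i \<noteq> \<one>\<^bsub>C l i\<^esub>}) \<and> finite ?J"
        using * by (simp add: J)
    next
      assume "(\<forall>l\<in>\<Lambda>. finite {i \<in> I l. x l i \<noteq> \<one>\<^bsub>C l i\<^esub>}) \<and> finite ?J"
      then show "finite (support x)" unfolding supp by (intro finite_SigmaI) auto
    qed
    finally show ?thesis .
  qed
  moreover have "carrier D \<subseteq> (\<Pi>\<^sub>E l\<in>\<Lambda>. \<Pi>\<^sub>E i\<in>I l. carrier (C l i))"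
    by (auto simp: double_sum_group_def carrier_sum_group group_sum_C group_C PiE_iff extensional_def)
  ultimately show ?thesis by blast
qed

lemma D_closed: "\<lbrakk>x \<in> carrier D; l \<in> \<Lambda>; i \<in> I l\<rbrakk> \<Longrightarrow> x l i \<in> carrier (C l i)"
  by (auto simp: carrier_D PiE_iff)

lemma D_component: "\<lbrakk>x \<in> carrier D; l \<in> \<Lambda>\<rbrakk> \<Longrightarrow> x l \<in> carrier (sum_group (I l) (C l))"
  by (auto simp: double_sum_group_def carrier_sum_group group_sum_C PiE_iff)

lemma D_eqI:
  assumes "x \<in> carrier D" "y \<in> carrier D"
    and "\<And>l i. \<lbrakk>l \<in> \<Lambda>; i \<in> I l\<rbrakk> \<Longrightarrow> x l i = y l i"
  shows "x = y"
proof -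
  let ?P = "\<lambda>l. \<Pi>\<^sub>E i\<in>I l. carrier (C l i)"
  have xy: "x \<in> Pi\<^sub>E \<Lambda> ?P" "y \<in> Pi\<^sub>E \<Lambda> ?P"
    using assms(1,2) by (auto simp only: carrier_D)
  show ?thesis
  proof (rule PiE_ext[OF xy])
    fix l assume l: "l \<in> \<Lambda>"
    show "x l = y l"
      by (rule PiE_ext[OF PiE_mem[OF xy(1) l] PiE_mem[OF xy(2) l]]) (rule assms(3)[OF l])
  qed
qed

lemma D_one: "\<one>\<^bsub>D\<^esub> = (\<lambda>l\<in>\<Lambda>. \<lambda>i\<in>I l. \<one>\<^bsub>C l i\<^esub>)"
  by (simp add: double_sum_group_def)

lemma D_one_apply [simp]: "\<lbrakk>l \<in> \<Lambda>; i \<in> I l\<rbrakk> \<Longrightarrow> \<one>\<^bsub>D\<^esub> l i = \<one>\<^bsub>C l i\<^esub>"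
  by (simp add: D_one)

lemma D_mult: "x \<otimes>\<^bsub>D\<^esub> y = (\<lambda>l\<in>\<Lambda>. \<lambda>i\<in>I l. x l i \<otimes>\<^bsub>C l i\<^esub> y l i)"
  by (simp add: double_sum_group_def)

lemma D_inv: "x \<in> carrier D \<Longrightarrow> inv\<^bsub>D\<^esub> x = (\<lambda>l\<in>\<Lambda>. \<lambda>i\<in>I l. inv\<^bsub>C l i\<^esub> x l i)"
proof -
  assume x: "x \<in> carrier D"
  have "inv\<^bsub>D\<^esub> x = (\<lambda>l\<in>\<Lambda>. inv\<^bsub>sum_group (I l) (C l)\<^esub> x l)"
    unfolding double_sum_group_def
    by (rule inv_sum_group[OF group_sum_C x[unfolded double_sum_group_def]])
  also have "\<dots> = (\<lambda>l\<in>\<Lambda>. \<lambda>i\<in>I l. inv\<^bsub>C l i\<^esub> x l i)"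
    by (intro restrict_ext inv_sum_group[OF group_C D_component[OF x]])
  finally show ?thesis .
qed

definition single :: "'l \<Rightarrow> 'i \<Rightarrow> 'c \<Rightarrow> 'l \<Rightarrow> 'i \<Rightarrow> 'c"
  where "single l i c = (\<lambda>m\<in>\<Lambda>. \<lambda>j\<in>I m. if (m, j) = (l, i) then c else \<one>\<^bsub>C m j\<^esub>)"

lemma single_apply [simp]:
  "\<lbrakk>m \<in> \<Lambda>; j \<in> I m\<rbrakk> \<Longrightarrow> single l i c m j = (if m = l \<and> j = i then c else \<one>\<^bsub>C m j\<^esub>)"
  by (simp add: single_def)

lemma one_C_closed: "\<lbrakk>l \<in> \<Lambda>; i \<in> I l\<rbrakk> \<Longrightarrow> \<one>\<^bsub>C l i\<^esub> \<in> carrier (C l i)"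
  by (simp add: group_C group.is_monoid)

lemma single_closed:
  assumes "l \<in> \<Lambda>" "i \<in> I l" "c \<in> carrier (C l i)"
  shows "single l i c \<in> carrier D"
proof -
  have "support (single l i c) \<subseteq> {(l, i)}" by (auto simp: support_def split: if_splits)
  then have "finite (support (single l i c))" by (rule finite_subset) simp
  then show ?thesis using assms by (auto simp: carrier_D single_def one_C_closed)
qed

lemma single_hom: "\<lbrakk>l \<in> \<Lambda>; i \<in> I l\<rbrakk> \<Longrightarrow> single l i \<in> hom (C l i) D"
proof (rule homI)
  fix c d assume "l \<in> \<Lambda>" "i \<in> I l" "c \<in> carrier (C l i)" "d \<in> carrier (C l i)"
  then show "single l i (c \<otimes>\<^bsub>C l i\<^esub> d) = single l i c \<otimes>\<^bsub>D\<^esub> single l i d"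
    by (auto simp: D_mult single_def group_C group.is_monoid intro!: restrict_ext)
qed (simp add: single_closed)

lemma single_eqI:
  assumes "x \<in> carrier D" "l \<in> \<Lambda>" "i \<in> I l"
    and "\<forall>m\<in>\<Lambda>. \<forall>j\<in>I m. (m, j) \<noteq> (l, i) \<longrightarrow> x m j = \<one>\<^bsub>C m j\<^esub>"
  shows "x = single l i (x l i)"
  using assms by (intro D_eqI) (auto simp: single_closed D_closed)

text \<open>
  The elements with a single nontrivial coordinate generate the direct sum. The set \<open>T\<close> records
  which coordinates are needed, so that the induction also runs inside the part of the sum
  supported on \<open>T\<close>.
\<close>

lemma D_induct [consumes 2, case_names one mult]:
  assumes "x \<in> carrier D" and "support x \<subseteq> T"
    and one: "P \<one>\<^bsub>D\<^esub>"
    and mult: "\<And>l i c y. \<lbrakk>(l, i) \<in> T; l \<in> \<Lambda>; i \<in> I l; c \<in> carrier (C l i); y \<in> carrier D; P y\<rbrakk>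
      \<Longrightarrow> P (single l i c \<otimes>\<^bsub>D\<^esub> y)"
  shows "P x"
proof -
  interpret D: group D by (rule group_D)
  have "P x" if "finite F" "F \<subseteq> T" "x \<in> carrier D" "support x \<subseteq> F" for F x
    using that
  proof (induction F arbitrary: x rule: finite_induct)
    case empty
    then have "x = \<one>\<^bsub>D\<^esub>"
      by (intro D_eqI) (auto simp: support_def)
    then show ?case using one by simp
  next
    case (insert p F)
    obtain l i where p: "p = (l, i)" by (cases p)
    show ?case
    proof (cases "l \<in> \<Lambda> \<and> i \<in> I l")
      case True
      let ?c = "x l i"
      let ?y = "inv\<^bsub>D\<^esub> single l i ?c \<otimes>\<^bsub>D\<^esub> x"
      have c: "?c \<in> carrier (C l i)" using insert.prems True by (simp add: D_closed)
      have single: "single l i ?c \<in> carrier D" using True c by (simp add: single_closed)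
      have y: "?y \<in> carrier D" using insert.prems single by simp
      have "?y m j = (if (m, j) = (l, i) then \<one>\<^bsub>C m j\<^esub> else x m j)" if "m \<in> \<Lambda>" "j \<in> I m" for m j
      proof -
        interpret Cmj: group "C m j" using that by (rule group_C)
        show ?thesis
          using that single D_closed[OF insert.prems(2) that] by (auto simp: D_mult D_inv group.l_inv[OF group_C])
      qed
      then have "support ?y = support x - {(l, i)}"
        by (auto simp: support_def split: if_splits)
      then have "support ?y \<subseteq> F" using insert.prems(3) p by blast
      then have "P ?y" using insert.IH insert.prems(1) y by blast
      then have "P (single l i ?c \<otimes>\<^bsub>D\<^esub> ?y)"
        using mult True c y insert.prems(1) p by blast
      then show ?thesis using single insert.prems by (simp flip: D.m_assoc)
    next
      case False
      then have "support x \<subseteq> F" using insert.prems p by (auto simp: support_def)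
      then show ?thesis using insert by blast
    qed
  qed
  from this[of "support x" x] show ?thesis using assms(1,2) by (auto simp: carrier_D)
qed

end

locale split_group_family = group_family \<Lambda> I C
  for \<Lambda> :: "'l set" and I :: "'l \<Rightarrow> 'i set" and C :: "'l \<Rightarrow> 'i \<Rightarrow> 'c monoid" +
  fixes \<Upsilon> :: "'l set"
  assumes \<Upsilon>_subset: "\<Upsilon> \<subseteq> \<Lambda>"
begin

sublocale rest: group_family "\<Lambda> - \<Upsilon>" I C
  by (rule group_family.intro) (simp add: group_C)

text \<open>
  Serves both as the embedding of the sum over \<open>\<Lambda> - \<Upsilon>\<close> into the full sum and, applied to
  elements of the full sum, as the projection that erases the coordinates over \<open>\<Upsilon>\<close>.
\<close>

definition ext :: "('l \<Rightarrow> 'i \<Rightarrow> 'c) \<Rightarrow> 'l \<Rightarrow> 'i \<Rightarrow> 'c"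
  where "ext x = (\<lambda>l\<in>\<Lambda>. \<lambda>i\<in>I l. if l \<in> \<Upsilon> then \<one>\<^bsub>C l i\<^esub> else x l i)"

lemma ext_apply [simp]:
  "\<lbrakk>l \<in> \<Lambda>; i \<in> I l\<rbrakk> \<Longrightarrow> ext x l i = (if l \<in> \<Upsilon> then \<one>\<^bsub>C l i\<^esub> else x l i)"
  by (simp add: ext_def)

lemma ext_closed:
  assumes "x \<in> carrier D \<or> x \<in> carrier rest.D"
  shows "ext x \<in> carrier D"
proof -
  have "support (ext x) \<subseteq> support x" "support (ext x) \<subseteq> rest.support x"
    by (auto simp: support_def rest.support_def split: if_splits)
  then have "finite (support (ext x))" 
    using assms by (auto simp: carrier_D rest.carrier_D intro: finite_subset)
  then show ?thesis
    using assms by (auto simp: carrier_D rest.carrier_D ext_def one_C_closed PiE_iff)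
qed

lemma ext_hom: "ext \<in> hom rest.D D"
proof (rule homI)
  fix x y assume "x \<in> carrier rest.D" "y \<in> carrier rest.D"
  then show "ext (x \<otimes>\<^bsub>rest.D\<^esub> y) = ext x \<otimes>\<^bsub>D\<^esub> ext y"
    unfolding D_mult rest.D_mult
    by (auto simp: ext_def group_C group.is_monoid intro!: restrict_ext)
qed (simp add: ext_closed)

lemma ext_inj: "inj_on ext (carrier rest.D)"
proof (rule inj_onI)
  fix x y assume *: "x \<in> carrier rest.D" "y \<in> carrier rest.D" "ext x = ext y"
  show "x = y"
  proof (rule rest.D_eqI[OF *(1,2)])
    fix l i assume "l \<in> \<Lambda> - \<Upsilon>" "i \<in> I l"
    then show "x l i = y l i" using fun_cong[OF fun_cong[OF *(3), of l], of i] by simp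
  qed
qed

lemma ext_image:
  "ext ` carrier rest.D = {x \<in> carrier D. \<forall>l\<in>\<Upsilon>. \<forall>i\<in>I l. x l i = \<one>\<^bsub>C l i\<^esub>}"
proof (intro equalityI subsetI)
  fix x assume x: "x \<in> {x \<in> carrier D. \<forall>l\<in>\<Upsilon>. \<forall>i\<in>I l. x l i = \<one>\<^bsub>C l i\<^esub>}"
  let ?y = "restrict x (\<Lambda> - \<Upsilon>)"
  have "rest.support ?y \<subseteq> support x" by (auto simp: support_def rest.support_def)
  then have y: "?y \<in> carrier rest.D"
    using x by (auto simp: carrier_D rest.carrier_D PiE_iff intro: finite_subset)
  moreover have "x = ext ?y"
    using x y by (intro D_eqI) (auto simp: ext_closed)
  ultimately show "x \<in> ext ` carrier rest.D" by blast
qed (use \<Upsilon>_subset in \<open>auto simp: ext_closed subset_iff\<close>)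

end

section \<open>Conjugation on the base\<close>

text \<open>
  The map \<open>f\<close> is arbitrary because this is needed for the base of \<open>W\<close> and for that of its quotient.
\<close>

lemma (in group_family) wreath_summand_eq:
  assumes "l \<in> \<Lambda>" "i \<in> I l"
  shows "wreath_summand \<Lambda> I C f l i = (\<lambda>c. f (single l i c)) ` carrier (C l i)"
proof -
  have "{x \<in> carrier D. \<forall>m\<in>\<Lambda>. \<forall>j\<in>I m. (m, j) \<noteq> (l, i) \<longrightarrow> x m j = \<one>\<^bsub>C m j\<^esub>}
      = single l i ` carrier (C l i)" (is "?S = _")
  proof (intro equalityI subsetI)
    fix x assume "x \<in> ?S"
    then show "x \<in> single l i ` carrier (C l i)"
      using assms single_eqI[of x l i] D_closed by blast
  next
    fix x assume "x \<in> single l i ` carrier (C l i)"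
    then show "x \<in> ?S" using assms by (auto simp: single_closed)
  qed
  then show ?thesis unfolding wreath_summand_def by (simp add: image_image)
qed

context wreath_like_product
begin

sublocale group_family \<Lambda> I C
  by (rule group_family.intro) (rule group_C)

sublocale W: group W
  using extension by (simp add: group_extension_def)

sublocale B: group B
  using extension by (simp add: group_extension_def)

sublocale D: group D
  by (rule group_D)

sublocale \<iota>: group_hom D W \<iota>
  using extension by unfold_locales (simp add: group_extension_def mon_def)

sublocale \<epsilon>: group_hom W B \<epsilon>
  using extension by unfold_locales (simp add: group_extension_def epi_def)

lemma \<iota>_inj: "inj_on \<iota> (carrier D)"
  using extension by (simp add: group_extension_def mon_def)

lemma \<epsilon>_onto: "\<epsilon> ` carrier W = carrier B"
  using extension by (simp add: group_extension_def epi_def)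

lemma image_\<iota>: "\<iota> ` carrier D = kernel W B \<epsilon>"
  using extension by (simp add: group_extension_def)

lemma \<epsilon>_\<iota>: "x \<in> carrier D \<Longrightarrow> \<epsilon> (\<iota> x) = \<one>\<^bsub>B\<^esub>"
  using image_\<iota>[THEN equalityD1] by (auto simp only: image_subset_iff kernel_def)

abbreviation act :: "'l \<Rightarrow> 'w \<Rightarrow> 'i \<Rightarrow> 'i"
  where "act l w i \<equiv> \<phi> l (\<epsilon> w) i"

lemma act_closed: "\<lbrakk>l \<in> \<Lambda>; w \<in> carrier W; i \<in> I l\<rbrakk> \<Longrightarrow> act l w i \<in> I l"
  by (rule group_action.element_image[OF action _ _ refl]) simp_all

lemma act_mult:
  "\<lbrakk>l \<in> \<Lambda>; v \<in> carrier W; w \<in> carrier W; i \<in> I l\<rbrakk>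
    \<Longrightarrow> act l (v \<otimes>\<^bsub>W\<^esub> w) i = act l v (act l w i)"
  using group_action.composition_rule[OF action] by simp

lemma act_inv:
  "\<lbrakk>l \<in> \<Lambda>; w \<in> carrier W; i \<in> I l\<rbrakk> \<Longrightarrow> act l (inv\<^bsub>W\<^esub> w) (act l w i) = i"
  using group_action.orbit_sym_aux[OF action] by simp

text \<open>
  Conjugation by \<open>w\<close>, transported from the base of \<open>W\<close> to the direct sum \<open>D\<close>.
\<close>

definition conj :: "'w \<Rightarrow> ('l \<Rightarrow> 'i \<Rightarrow> 'c) \<Rightarrow> 'l \<Rightarrow> 'i \<Rightarrow> 'c"
  where "conj w x = inv_into (carrier D) \<iota> (w \<otimes>\<^bsub>W\<^esub> \<iota> x \<otimes>\<^bsub>W\<^esub> inv\<^bsub>W\<^esub> w)"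

lemma conj:
  assumes w: "w \<in> carrier W" and x: "x \<in> carrier D"
  shows conj_closed: "conj w x \<in> carrier D"
    and \<iota>_conj: "\<iota> (conj w x) = w \<otimes>\<^bsub>W\<^esub> \<iota> x \<otimes>\<^bsub>W\<^esub> inv\<^bsub>W\<^esub> w"
proof -
  have "w \<otimes>\<^bsub>W\<^esub> \<iota> x \<otimes>\<^bsub>W\<^esub> inv\<^bsub>W\<^esub> w \<in> \<iota> ` carrier D"
    using assms by (simp add: image_\<iota> kernel_def \<epsilon>_\<iota>)
  then show "conj w x \<in> carrier D" "\<iota> (conj w x) = w \<otimes>\<^bsub>W\<^esub> \<iota> x \<otimes>\<^bsub>W\<^esub> inv\<^bsub>W\<^esub> w"
    unfolding conj_def by (rule inv_into_into, rule f_inv_into_f)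
qed

lemma conj_eqI:
  assumes "w \<in> carrier W" "x \<in> carrier D" "y \<in> carrier D"
    and "\<iota> y = w \<otimes>\<^bsub>W\<^esub> \<iota> x \<otimes>\<^bsub>W\<^esub> inv\<^bsub>W\<^esub> w"
  shows "conj w x = y"
  using \<iota>_inj assms by (intro inj_onD[OF \<iota>_inj]) (simp_all add: conj)

lemma conj_hom: "w \<in> carrier W \<Longrightarrow> conj w \<in> hom D D"
proof (rule homI)
  fix x y assume w: "w \<in> carrier W" and x: "x \<in> carrier D" and y: "y \<in> carrier D"
  show "conj w (x \<otimes>\<^bsub>D\<^esub> y) = conj w x \<otimes>\<^bsub>D\<^esub> conj w y"
  proof (rule conj_eqI)
    have "inv\<^bsub>W\<^esub> w \<otimes>\<^bsub>W\<^esub> (w \<otimes>\<^bsub>W\<^esub> z) = z" if "z \<in> carrier W" for z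
      using w that by (simp flip: W.m_assoc)
    then show "\<iota> (conj w x \<otimes>\<^bsub>D\<^esub> conj w y) = w \<otimes>\<^bsub>W\<^esub> \<iota> (x \<otimes>\<^bsub>D\<^esub> y) \<otimes>\<^bsub>W\<^esub> inv\<^bsub>W\<^esub> w"
      using w x y by (simp add: conj W.m_assoc)
  qed (use w x y in \<open>simp_all add: conj\<close>)
qed (simp add: conj)

lemma conj_comp:
  assumes "v \<in> carrier W" "w \<in> carrier W" "x \<in> carrier D"
  shows "conj (v \<otimes>\<^bsub>W\<^esub> w) x = conj v (conj w x)"
  using assms by (intro conj_eqI) (simp_all add: conj W.m_assoc W.inv_mult_group)

text \<open>
  The conjugation axiom in coordinates: conjugation permutes the summands along the action. It
  says nothing about the element \<open>d\<close>; controlling \<open>d\<close> is what untwistedness is for.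
\<close>

lemma conj_single:
  assumes w: "w \<in> carrier W" and l: "l \<in> \<Lambda>" and i: "i \<in> I l" and c: "c \<in> carrier (C l i)"
  shows "\<exists>d \<in> carrier (C l (act l w i)). conj w (single l i c) = single l (act l w i) d"
proof -
  have "\<iota> (conj w (single l i c)) \<in> w <#\<^bsub>W\<^esub> wreath_summand \<Lambda> I C \<iota> l i #>\<^bsub>W\<^esub> inv\<^bsub>W\<^esub> w"
    using assms by (auto simp: wreath_summand_eq conj single_closed l_coset_def r_coset_def)
  then obtain d where d: "d \<in> carrier (C l (act l w i))"
    and "\<iota> (conj w (single l i c)) = \<iota> (single l (act l w i) d)"
    unfolding conjugation[OF w l i] wreath_summand_eq[OF l act_closed[OF l w i]] by blast
  then have "conj w (single l i c) = single l (act l w i) d"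
    using assms by (intro inj_onD[OF \<iota>_inj]) (simp_all add: conj single_closed act_closed)
  then show ?thesis using d by blast
qed

end

context untwisted_wreath_like_product
begin

lemma conj_single_fixed:
  assumes w: "w \<in> carrier W" and l: "l \<in> \<Lambda>" and i: "i \<in> I l" and c: "c \<in> carrier (C l i)"
    and fixed: "act l w i = i"
  shows "conj w (single l i c) = single l i c"
proof (rule conj_eqI)
  have "w \<in> centralizer W (wreath_summand \<Lambda> I C \<iota> l i)"
    using untwisted[OF l i] w fixed by (auto simp: stabilizer_def)
  then have "w \<otimes>\<^bsub>W\<^esub> \<iota> (single l i c) = \<iota> (single l i c) \<otimes>\<^bsub>W\<^esub> w"
    using l i c by (simp add: centralizer_def wreath_summand_eq)
  then show "\<iota> (single l i c) = w \<otimes>\<^bsub>W\<^esub> \<iota> (single l i c) \<otimes>\<^bsub>W\<^esub> inv\<^bsub>W\<^esub> w"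
    using w l i c by (simp add: single_closed W.m_assoc)
qed (use assms in \<open>simp_all add: single_closed\<close>)

text \<open>
  The base acts trivially on every \<open>I l\<close>, so its elements fix every index. Untwistedness
  therefore makes each summand commute with the whole base, in particular with itself.
\<close>

lemma comm_group_A:
  assumes l: "l \<in> \<Lambda>" and i: "i \<in> I l"
  shows "comm_group (A l)"
proof -
  interpret Cli: group "C l i" using l i by (rule group_C)
  have "comm_group (C l i)"
  proof (rule Cli.group_comm_groupI)
    fix c d assume c: "c \<in> carrier (C l i)" and d: "d \<in> carrier (C l i)"
    have "act l (\<iota> (single l i c)) i = i"
      using l i c by (simp add: \<epsilon>_\<iota> single_closed flip: group_action.id_eq_one[OF action])
    then have "conj (\<iota> (single l i c)) (single l i d) = single l i d"
      using l i c d by (simp add: conj_single_fixed single_closed)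
    then have "\<iota> (single l i c \<otimes>\<^bsub>D\<^esub> single l i d) = \<iota> (single l i d \<otimes>\<^bsub>D\<^esub> single l i c)"
      using l i c d \<iota>_conj[of "\<iota> (single l i c)" "single l i d"]
      by (simp add: single_closed W.inv_solve_right)
    then have "single l i c \<otimes>\<^bsub>D\<^esub> single l i d = single l i d \<otimes>\<^bsub>D\<^esub> single l i c"
      using l i c d by (intro inj_onD[OF \<iota>_inj]) (simp_all add: single_closed)
    then have "single l i (c \<otimes>\<^bsub>C l i\<^esub> d) = single l i (d \<otimes>\<^bsub>C l i\<^esub> c)"
      using l i c d by (simp add: hom_mult[OF single_hom])
    then have "single l i (c \<otimes>\<^bsub>C l i\<^esub> d) l i = single l i (d \<otimes>\<^bsub>C l i\<^esub> c) l i" by simp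
    then show "c \<otimes>\<^bsub>C l i\<^esub> d = d \<otimes>\<^bsub>C l i\<^esub> c" using l i by simp
  qed
  then show ?thesis
    by (rule comm_group.iso_imp_comm_group[OF _ iso_C[OF l i] group.is_monoid[OF group_A[OF l]]])
qed

text \<open>
  Transitivity and untwistedness let all summands of index \<open>l\<close> be identified with \<open>A l\<close>
  compatibly with conjugation. Fix a base point \<open>i0\<close> and an isomorphism \<open>h\<close> of the summand there
  with \<open>A l\<close>; conjugate the summand at \<open>i\<close> to the one at \<open>i0\<close> by some element carrying \<open>i\<close> to
  \<open>i0\<close>, then apply \<open>h\<close>. Two such elements differ by one fixing \<open>i0\<close>, which centralizes the
  summand at \<open>i0\<close>, so the choice does not matter, and independence of the choice is equivariance.
  Of the bijectivity of these maps only surjectivity at one index is recorded, which suffices for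
  the sum over all indices to be onto.
\<close>

lemma equivariant_maps:
  assumes l: "l \<in> \<Lambda>" and transitive: "nonempty_transitive_action B (I l) (\<phi> l)"
  obtains \<theta> where "\<And>i. i \<in> I l \<Longrightarrow> \<theta> i \<in> hom (C l i) (A l)"
    and "\<exists>i\<in>I l. \<theta> i ` carrier (C l i) = carrier (A l)"
    and "\<And>w i c d. \<lbrakk>w \<in> carrier W; i \<in> I l; c \<in> carrier (C l i); d \<in> carrier (C l (act l w i));
      conj w (single l i c) = single l (act l w i) d\<rbrakk> \<Longrightarrow> \<theta> (act l w i) d = \<theta> i c"
proof -
  interpret nonempty_transitive_action B "I l" "\<phi> l" by (rule transitive)
  obtain i0 where i0: "i0 \<in> I l" using nonempty by blast
  obtain h where h: "h \<in> iso (C l i0) (A l)" using iso_C[OF l i0] by (auto simp: is_iso_def)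
  have "\<exists>t\<in>carrier W. act l t i = i0" if "i \<in> I l" for i
    using unique_orbit[OF that i0] \<epsilon>_onto by (metis imageE)
  then obtain t where t: "\<And>i. i \<in> I l \<Longrightarrow> t i \<in> carrier W" "\<And>i. i \<in> I l \<Longrightarrow> act l (t i) i = i0"
    by metis
  define \<theta> where "\<theta> i c = h (conj (t i) (single l i c) l i0)" for i c
  have independent: "conj v (single l i c) = conj u (single l i c)"
    if i: "i \<in> I l" and c: "c \<in> carrier (C l i)"
      and u_W: "u \<in> carrier W" and "v \<in> carrier W" and u: "act l u i = i0" and v: "act l v i = i0" for u v i c
  proof -
    have "act l (inv\<^bsub>W\<^esub> u) i0 = i"
      using act_inv[OF l, of u i] that by simp
    then have fixed: "act l (v \<otimes>\<^bsub>W\<^esub> inv\<^bsub>W\<^esub> u) i0 = i0"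
      using that l i0 by (simp only: act_mult W.inv_closed)
    obtain d where d: "d \<in> carrier (C l i0)" "conj u (single l i c) = single l i0 d"
      using conj_single[OF u_W l i c] unfolding u by blast
    have "conj v (single l i c) = conj (v \<otimes>\<^bsub>W\<^esub> inv\<^bsub>W\<^esub> u \<otimes>\<^bsub>W\<^esub> u) (single l i c)"
      using that by (simp add: W.m_assoc)
    also have "\<dots> = conj (v \<otimes>\<^bsub>W\<^esub> inv\<^bsub>W\<^esub> u) (conj u (single l i c))"
      using that l by (intro conj_comp) (simp_all add: single_closed)
    also have "\<dots> = conj u (single l i c)"
      unfolding d(2) using that l i0 d fixed by (intro conj_single_fixed) simp_all
    finally show ?thesis .
  qed
  show thesis
  proof (rule that[of \<theta>])
    fix i assume i: "i \<in> I l"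
    have "(\<lambda>x. x l i0) \<in> hom D (C l i0)"
      using l i0 by (intro homI) (simp_all add: D_closed D_mult)
    then have "h \<circ> ((\<lambda>x. x l i0) \<circ> (conj (t i) \<circ> single l i)) \<in> hom (C l i) (A l)"
      using h t[OF i] l i by (intro hom_compose[OF hom_compose[OF hom_compose[OF single_hom conj_hom]]])
        (auto simp: iso_def)
    then show "\<theta> i \<in> hom (C l i) (A l)"
      by (simp add: \<theta>_def[abs_def] o_def)
  next
    have "\<theta> i0 c = h c" if "c \<in> carrier (C l i0)" for c
      using conj_single_fixed[OF t(1)[OF i0] l i0 that t(2)[OF i0]] l i0 by (simp add: \<theta>_def)
    then have "\<theta> i0 ` carrier (C l i0) = h ` carrier (C l i0)"
      by (rule image_cong[OF refl])
    also have "\<dots> = carrier (A l)"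
      using h by (simp add: iso_def bij_betw_def)
    finally have "\<theta> i0 ` carrier (C l i0) = carrier (A l)" .
    then show "\<exists>i\<in>I l. \<theta> i ` carrier (C l i) = carrier (A l)" using i0 by blast
  next
    fix w i c d
    assume w: "w \<in> carrier W" and i: "i \<in> I l" and c: "c \<in> carrier (C l i)"
      and d: "d \<in> carrier (C l (act l w i))"
      and eq: "conj w (single l i c) = single l (act l w i) d"
    let ?j = "act l w i"
    have j: "?j \<in> I l" using l w i by (rule act_closed)
    have "conj (t ?j) (single l ?j d) = conj (t ?j \<otimes>\<^bsub>W\<^esub> w) (single l i c)"
      unfolding eq[symmetric] using t(1)[OF j] w l i c by (intro conj_comp[symmetric]) (simp_all add: single_closed)
    also have "\<dots> = conj (t i) (single l i c)"
    proof (rule independent[OF i c t(1)[OF i] _ t(2)[OF i]])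
      show "act l (t ?j \<otimes>\<^bsub>W\<^esub> w) i = i0"
        using act_mult[OF l t(1)[OF j] w i] t(2)[OF j] by simp
    qed (use t(1)[OF j] w in simp)
    finally show "\<theta> ?j d = \<theta> i c" by (simp add: \<theta>_def)
  qed
qed

text \<open>
  Since \<open>A l\<close> is abelian, the equivariant maps can be summed over \<open>I l\<close>. Conjugation permutes the
  terms of this sum, so the result is invariant; it suffices to see this on the generators with
  a single nontrivial coordinate.
\<close>

lemma invariant_sum:
  assumes l: "l \<in> \<Lambda>" and transitive: "nonempty_transitive_action B (I l) (\<phi> l)"
  obtains S where "S \<in> hom (sum_group (I l) (C l)) (A l)"
    and "S ` carrier (sum_group (I l) (C l)) = carrier (A l)"
    and "\<And>w x. \<lbrakk>w \<in> carrier W; x \<in> carrier D\<rbrakk> \<Longrightarrow> S (conj w x l) = S (x l)"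
proof -
  obtain \<theta> where \<theta>: "\<And>i. i \<in> I l \<Longrightarrow> \<theta> i \<in> hom (C l i) (A l)"
    and \<theta>_onto: "\<exists>i\<in>I l. \<theta> i ` carrier (C l i) = carrier (A l)"
    and equivariant: "\<And>w i c d. \<lbrakk>w \<in> carrier W; i \<in> I l; c \<in> carrier (C l i);
      d \<in> carrier (C l (act l w i)); conj w (single l i c) = single l (act l w i) d\<rbrakk>
      \<Longrightarrow> \<theta> (act l w i) d = \<theta> i c"
  proof (rule equivariant_maps[OF l transitive], goal_cases)
    case (1 \<theta>)
    show thesis by (rule 1(1)[OF 1(2-4)])
  qed
  have "I l \<noteq> {}" by (rule nonempty_transitive_action.nonempty[OF transitive])
  then interpret Al: comm_group "A l" using comm_group_A[OF l] by blast
  interpret SC: group "sum_group (I l) (C l)" using l by (rule group_sum_C)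
  define S where "S y = gfinprod (A l) (\<lambda>i. \<theta> i (y i)) (I l)" for y
  have S: "S \<in> hom (sum_group (I l) (C l)) (A l)"
    unfolding S_def using \<theta> group_C[OF l] by (rule Al.hom_group_sum)
  interpret S: group_hom "sum_group (I l) (C l)" "A l" S by unfold_locales (rule S)
  have \<theta>_closed: "\<theta> i c \<in> carrier (A l)" if "i \<in> I l" "c \<in> carrier (C l i)" for i c
    using hom_in_carrier[OF \<theta>] that by blast
  have \<theta>_one: "\<theta> i \<one>\<^bsub>C l i\<^esub> = \<one>\<^bsub>A l\<^esub>" if "i \<in> I l" for i
    using hom_one[OF \<theta>[OF that] group_C[OF l that] Al.is_group] .
  have S_single: "S (single l i c l) = \<theta> i c" if i: "i \<in> I l" and c: "c \<in> carrier (C l i)" for i c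
  proof -
    have "S (single l i c l) = gfinprod (A l) (\<lambda>i. \<theta> i (single l i c l i)) {i}"
      unfolding S_def using l i c 
      by (intro Al.gfinprod_mono_neutral_cong_right) (auto simp: \<theta>_one \<theta>_closed one_C_closed)
    also have "\<dots> = \<theta> i c" using l i c by (simp add: \<theta>_closed)
    finally show ?thesis .
  qed
  have S_single_other: "S (single m i c l) = \<one>\<^bsub>A l\<^esub>" if "m \<noteq> l" for m i c
  proof -
    have "single m i c l = \<one>\<^bsub>sum_group (I l) (C l)\<^esub>"
      using l that by (auto simp: single_def)
    then show ?thesis by (simp only: S.hom_one)
  qed
  have S_mult: "S ((x \<otimes>\<^bsub>D\<^esub> y) l) = S (x l) \<otimes>\<^bsub>A l\<^esub> S (y l)"
    if "x \<in> carrier D" "y \<in> carrier D" for x y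
  proof -
    have "(x \<otimes>\<^bsub>D\<^esub> y) l = x l \<otimes>\<^bsub>sum_group (I l) (C l)\<^esub> y l"
      using l by (simp add: D_mult)
    then show ?thesis using that l by (simp only: S.hom_mult D_component)
  qed
  show thesis
  proof (rule that[OF S])
    obtain i where i: "i \<in> I l" "\<theta> i ` carrier (C l i) = carrier (A l)"
      using \<theta>_onto by blast
    have "a \<in> S ` carrier (sum_group (I l) (C l))" if a: "a \<in> carrier (A l)" for a
    proof -
      obtain c where c: "c \<in> carrier (C l i)" "a = \<theta> i c" using a i(2) by blast
      show ?thesis
        by (rule image_eqI[of _ _ "single l i c l"])
          (simp_all only: c S_single[OF i(1)] D_component[OF single_closed[OF l i(1)] l])
    qed
    then show "S ` carrier (sum_group (I l) (C l)) = carrier (A l)"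
      by (intro equalityI subsetI) (auto simp only: S.hom_closed)
  next
    fix w x assume w: "w \<in> carrier W" and x: "x \<in> carrier D"
    from x subset_UNIV[of "support x"] show "S (conj w x l) = S (x l)"
    proof (induction x rule: D_induct)
      case one
      show ?case using hom_one[OF conj_hom[OF w] D.is_group D.is_group] by simp
    next
      case (mult m i c y)
      have single: "single m i c \<in> carrier D" using mult.hyps by (simp add: single_closed)
      obtain d where d: "d \<in> carrier (C m (act m w i))" "conj w (single m i c) = single m (act m w i) d"
        using conj_single[OF w] mult.hyps by blast
      have "S (conj w (single m i c) l) = S (single m i c l)"
      proof (cases "m = l")
        case True
        then show ?thesis
          using equivariant[OF w] mult.hyps d by (simp add: S_single act_closed[OF l w])
      next
        case False
        then show ?thesis by (simp add: d S_single_other)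
      qed
      then show ?case
        using single mult w by (simp add: hom_mult[OF conj_hom[OF w]] S_mult conj_closed)
    qed
  qed
qed

end

section \<open>Quotients of wreath-like products\<close>

lemma l_coset_r_coset_eq_image:
  "g <#\<^bsub>G\<^esub> S #>\<^bsub>G\<^esub> h = (\<lambda>x. g \<otimes>\<^bsub>G\<^esub> x \<otimes>\<^bsub>G\<^esub> h) ` S"
  by (auto simp: l_coset_def r_coset_def)

lemma (in group_hom) image_conjugate:
  assumes "S \<subseteq> carrier G" and "g \<in> carrier G"
  shows "h g <#\<^bsub>H\<^esub> h ` S #>\<^bsub>H\<^esub> inv\<^bsub>H\<^esub> h g = h ` (g <# S #> inv g)"
proof -
  have "h g \<otimes>\<^bsub>H\<^esub> h x \<otimes>\<^bsub>H\<^esub> inv\<^bsub>H\<^esub> h g = h (g \<otimes> x \<otimes> inv g)" if "x \<in> S" for x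
    using assms that by (simp add: subset_iff)
  then show ?thesis
    by (simp add: l_coset_r_coset_eq_image image_image cong: image_cong)
qed

lemma (in group_hom) image_centralizer:
  assumes "S \<subseteq> carrier G" and "g \<in> centralizer G S"
  shows "h g \<in> centralizer H (h ` S)"
proof -
  have "h g \<otimes>\<^bsub>H\<^esub> h x = h x \<otimes>\<^bsub>H\<^esub> h g" if "x \<in> S" for x
  proof -
    have "x \<in> carrier G" "g \<in> carrier G" "g \<otimes> x = x \<otimes> g"
      using assms that by (auto simp: centralizer_def)
    then show ?thesis by (simp flip: hom_mult)
  qed
  then show ?thesis using assms(2) by (simp add: centralizer_def)
qed

lemma (in group_family) subgroup_supported:
  "subgroup {x \<in> carrier D. support x \<subseteq> T} D"
proof -
  interpret D: group D by (rule group_D)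
  have mult: "support (x \<otimes>\<^bsub>D\<^esub> y) \<subseteq> support x \<union> support y" for x y
    by (auto simp: support_def D_mult group_C group.is_monoid one_C_closed)
  have inv: "support (inv\<^bsub>D\<^esub> x) \<subseteq> support x" if "x \<in> carrier D" for x
    using that by (auto simp: support_def D_inv monoid.inv_one[OF group.is_monoid[OF group_C]])
  show ?thesis
  proof (rule subgroup.intro)
    fix x y assume "x \<in> {x \<in> carrier D. support x \<subseteq> T}" "y \<in> {x \<in> carrier D. support x \<subseteq> T}"
    then show "x \<otimes>\<^bsub>D\<^esub> y \<in> {x \<in> carrier D. support x \<subseteq> T}"
      by (simp add: subset_trans[OF mult])
  next
    fix x assume "x \<in> {x \<in> carrier D. support x \<subseteq> T}"
    then show "inv\<^bsub>D\<^esub> x \<in> {x \<in> carrier D. support x \<subseteq> T}"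
      by (simp add: subset_trans[OF inv])
  next
    have "support \<one>\<^bsub>D\<^esub> = {}" by (auto simp: support_def)
    then show "\<one>\<^bsub>D\<^esub> \<in> {x \<in> carrier D. support x \<subseteq> T}" by simp
  qed auto
qed

text \<open>
  The base of \<open>W\<close> splits as the product of its part \<open>M\<close> over \<open>\<Upsilon>\<close> and its part \<open>L\<close> over
  \<open>\<Lambda> - \<Upsilon>\<close>. Dividing by \<open>M\<close> removes the indices in \<open>\<Upsilon>\<close> from the wreath-like product.
\<close>

locale wreath_quotient = untwisted_wreath_like_product \<Lambda> A B I \<phi> W C \<iota> \<epsilon>
  for \<Lambda> :: "'l set" and A :: "'l \<Rightarrow> 'a monoid" and B :: "'b monoid" and I :: "'l \<Rightarrow> 'i set"
    and \<phi> :: "'l \<Rightarrow> 'b \<Rightarrow> 'i \<Rightarrow> 'i" and W :: "'w monoid" and C :: "'l \<Rightarrow> 'i \<Rightarrow> 'c monoid"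
    and \<iota> :: "('l \<Rightarrow> 'i \<Rightarrow> 'c) \<Rightarrow> 'w" and \<epsilon> :: "'w \<Rightarrow> 'b" +
  fixes \<Upsilon> :: "'l set"
  assumes \<Upsilon>_subset: "\<Upsilon> \<subseteq> \<Lambda>"
begin

sublocale split_group_family \<Lambda> I C \<Upsilon>
  by unfold_locales (rule \<Upsilon>_subset)

definition M :: "'w set"
  where "M = \<iota> ` {x \<in> carrier D. support x \<subseteq> \<Upsilon> \<times> UNIV}"

definition L :: "'w set"
  where "L = (\<lambda>y. \<iota> (ext y)) ` carrier rest.D"

text \<open>
  Conjugation moves a coordinate \<open>(l, i)\<close> only within \<open>I l\<close>, hence preserves \<open>\<Upsilon> \<times> UNIV\<close>.
\<close>

lemma support_conj:
  assumes w: "w \<in> carrier W" and x: "x \<in> carrier D" "support x \<subseteq> \<Upsilon> \<times> UNIV"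
  shows "support (conj w x) \<subseteq> \<Upsilon> \<times> UNIV"
proof -
  let ?K = "{x \<in> carrier D. support x \<subseteq> \<Upsilon> \<times> UNIV}"
  interpret K: subgroup ?K D by (rule subgroup_supported)
  from x have "conj w x \<in> ?K"
  proof (induction x rule: D_induct)
    case one
    show ?case
      unfolding hom_one[OF conj_hom[OF w] D.is_group D.is_group] by (rule K.one_closed)
  next
    case (mult l i c y)
    obtain d where d: "d \<in> carrier (C l (act l w i))" "conj w (single l i c) = single l (act l w i) d"
      using conj_single[OF w mult.hyps(2-4)] by blast
    have "support (single l (act l w i) d) \<subseteq> {(l, act l w i)}"
      by (auto simp: support_def split: if_splits)
    also have "\<dots> \<subseteq> \<Upsilon> \<times> UNIV" using mult.hyps(1) by simp
    finally have "conj w (single l i c) \<in> ?K"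
      using single_closed[OF mult.hyps(2) act_closed[OF mult.hyps(2) w mult.hyps(3)] d(1)]
      unfolding d(2) by blast
    then have "conj w (single l i c) \<otimes>\<^bsub>D\<^esub> conj w y \<in> ?K"
      using mult.IH by (rule K.m_closed)
    then show ?case
      unfolding hom_mult[OF conj_hom[OF w] single_closed[OF mult.hyps(2-4)] mult.hyps(5)] .
  qed
  then show ?thesis by blast
qed

lemma M_normal: "M \<lhd> W"
proof (rule W.normal_invI)
  show "subgroup M W"
    unfolding M_def by (rule \<iota>.subgroup_img_is_subgroup[OF subgroup_supported])
  fix w m assume w: "w \<in> carrier W" and "m \<in> M"
  then obtain x where x: "x \<in> carrier D" "support x \<subseteq> \<Upsilon> \<times> UNIV" "m = \<iota> x"
    unfolding M_def by blast
  show "w \<otimes>\<^bsub>W\<^esub> m \<otimes>\<^bsub>W\<^esub> inv\<^bsub>W\<^esub> w \<in> M"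
    unfolding M_def x(3) \<iota>_conj[OF w x(1), symmetric]
    by (intro imageI CollectI conjI conj_closed[OF w x(1)] support_conj[OF w x(1,2)])
qed

sublocale M: normal M W
  by (rule M_normal)

lemma \<iota>_ext_hom: "(\<lambda>y. \<iota> (ext y)) \<in> hom rest.D W"
  using hom_compose[OF ext_hom \<iota>.homh] by (simp add: o_def)

lemma L_subgroup: "subgroup L W"
proof -
  interpret \<iota>_ext: group_hom rest.D W "\<lambda>y. \<iota> (ext y)"
    by (intro group_hom.intro group_hom_axioms.intro rest.group_D W.is_group \<iota>_ext_hom)
  show ?thesis unfolding L_def by (rule \<iota>_ext.img_is_subgroup)
qed

lemma L_Int_M: "L \<inter> M \<subseteq> {\<one>\<^bsub>W\<^esub>}"
proof
  fix u assume "u \<in> L \<inter> M"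
  then obtain x y where x: "x \<in> carrier D" "support x \<subseteq> \<Upsilon> \<times> UNIV" "u = \<iota> x"
    and y: "y \<in> carrier rest.D" "u = \<iota> (ext y)"
    unfolding L_def M_def by blast
  then have eq: "ext y = x"
    by (intro inj_onD[OF \<iota>_inj]) (simp_all add: ext_closed)
  have "x = \<one>\<^bsub>D\<^esub>"
  proof (rule D_eqI[OF x(1) D.one_closed])
    fix l i assume li: "l \<in> \<Lambda>" "i \<in> I l"
    show "x l i = \<one>\<^bsub>D\<^esub> l i"
    proof (cases "l \<in> \<Upsilon>")
      case True
      then show ?thesis using li by (simp flip: eq)
    next
      case False
      then show ?thesis using li x(2) by (auto simp: support_def)
    qed
  qed
  then show "u \<in> {\<one>\<^bsub>W\<^esub>}" using x(3) by simp
qed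

lemma rcos_ext:
  assumes x: "x \<in> carrier D"
  shows "M #>\<^bsub>W\<^esub> \<iota> x = M #>\<^bsub>W\<^esub> \<iota> (ext x)"
proof -
  have ext: "ext x \<in> carrier D" using x by (simp add: ext_closed)
  let ?z = "x \<otimes>\<^bsub>D\<^esub> inv\<^bsub>D\<^esub> ext x"
  have "?z l i = \<one>\<^bsub>C l i\<^esub>" if "l \<in> \<Lambda>" "i \<in> I l" "l \<notin> \<Upsilon>" for l i
    using that ext group.r_inv[OF group_C D_closed[OF x]] by (simp add: D_mult D_inv)
  then have "support ?z \<subseteq> \<Upsilon> \<times> UNIV"
    by (auto simp: support_def)
  then have "\<iota> ?z \<in> M" unfolding M_def using x ext by blast
  then show ?thesis
    using x ext by (simp add: M.rcos_eq_iff[OF W.is_group])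
qed

text \<open>
  Modulo \<open>M\<close> every base element can be replaced by its part over \<open>\<Lambda> - \<Upsilon>\<close>, so \<open>L\<close> already
  covers the base of the quotient.
\<close>

lemma rcos_base: "(\<lambda>u. M #>\<^bsub>W\<^esub> u) ` \<iota> ` carrier D = (\<lambda>u. M #>\<^bsub>W\<^esub> u) ` L"
proof (intro equalityI subsetI)
  fix a assume "a \<in> (\<lambda>u. M #>\<^bsub>W\<^esub> u) ` \<iota> ` carrier D"
  then obtain x where x: "x \<in> carrier D" "a = M #>\<^bsub>W\<^esub> \<iota> x" by blast
  have "ext x \<in> ext ` carrier rest.D"
    unfolding ext_image using x(1) subsetD[OF \<Upsilon>_subset] by (simp add: ext_closed)
  then obtain y where y: "y \<in> carrier rest.D" "ext x = ext y" by (rule imageE)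
  have "a = M #>\<^bsub>W\<^esub> \<iota> (ext y)" unfolding x(2) rcos_ext[OF x(1)] y(2) ..
  moreover have "\<iota> (ext y) \<in> L" unfolding L_def using y(1) by (rule imageI)
  ultimately show "a \<in> (\<lambda>u. M #>\<^bsub>W\<^esub> u) ` L" by (rule image_eqI)
next
  fix a assume "a \<in> (\<lambda>u. M #>\<^bsub>W\<^esub> u) ` L"
  then obtain y where y: "y \<in> carrier rest.D" "a = M #>\<^bsub>W\<^esub> \<iota> (ext y)"
    unfolding L_def by blast
  show "a \<in> (\<lambda>u. M #>\<^bsub>W\<^esub> u) ` \<iota> ` carrier D"
    unfolding y(2) by (rule imageI[OF imageI[OF hom_in_carrier[OF ext_hom y(1)]]])
qed

text \<open>
  The summands of the quotient are the images of the summands of \<open>W\<close> with index in \<open>\<Lambda> - \<Upsilon>\<close>,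
  so the conjugation rule and the centralizer condition are inherited by applying the quotient
  homomorphism to them. The embedding of the base stays injective because it factors through
  \<open>L\<close>, which meets \<open>M\<close> trivially.
\<close>

lemma untwisted_quotient:
  assumes \<epsilon>'_hom: "\<epsilon>' \<in> hom (W Mod M) B"
    and \<epsilon>': "\<And>w. w \<in> carrier W \<Longrightarrow> \<epsilon>' (M #>\<^bsub>W\<^esub> w) = \<epsilon> w"
  shows "untwisted_wreath_like_product (\<Lambda> - \<Upsilon>) A B I \<phi> (W Mod M) C (\<lambda>y. M #>\<^bsub>W\<^esub> \<iota> (ext y)) \<epsilon>'"
proof -
  let ?\<iota> = "\<lambda>y. M #>\<^bsub>W\<^esub> \<iota> (ext y)"
  interpret \<rho>: group_hom W "W Mod M" "\<lambda>w. M #>\<^bsub>W\<^esub> w"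
    by (intro group_hom.intro group_hom_axioms.intro W.is_group M.factorgroup_is_group
        M.r_coset_hom_Mod)
  have \<iota>'_hom: "?\<iota> \<in> hom rest.D (W Mod M)"
    using hom_compose[OF \<iota>_ext_hom \<rho>.homh] by (simp add: o_def)
  have \<iota>'_inj: "inj_on ?\<iota> (carrier rest.D)"
  proof -
    have "inj_on ((\<lambda>u. M #>\<^bsub>W\<^esub> u) \<circ> (\<iota> \<circ> ext)) (carrier rest.D)"
    proof (intro comp_inj_on)
      show "inj_on ext (carrier rest.D)" by (rule ext_inj)
      show "inj_on \<iota> (ext ` carrier rest.D)"
        by (rule inj_on_subset[OF \<iota>_inj]) (auto simp: ext_closed)
      show "inj_on (\<lambda>u. M #>\<^bsub>W\<^esub> u) ((\<iota> \<circ> ext) ` carrier rest.D)"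
        using M.inj_on_rcos_complement[OF W.is_group L_subgroup L_Int_M]
        by (simp add: L_def o_def)
    qed
    then show ?thesis by (simp add: o_def)
  qed
  have \<epsilon>'_onto: "\<epsilon>' ` carrier (W Mod M) = carrier B"
    unfolding carrier_FactGroup image_image using \<epsilon>' \<epsilon>_onto by (simp cong: image_cong)
  have exact: "?\<iota> ` carrier rest.D = kernel (W Mod M) B \<epsilon>'"
  proof -
    have "kernel (W Mod M) B \<epsilon>' = (\<lambda>u. M #>\<^bsub>W\<^esub> u) ` kernel W B \<epsilon>"
      unfolding kernel_def carrier_FactGroup using \<epsilon>' by auto
    also have "\<dots> = (\<lambda>u. M #>\<^bsub>W\<^esub> u) ` L"
      by (simp only: rcos_base flip: image_\<iota>)
    also have "\<dots> = ?\<iota> ` carrier rest.D" by (simp only: L_def image_image)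
    finally show ?thesis by (rule sym)
  qed
  have summand: "wreath_summand (\<Lambda> - \<Upsilon>) I C ?\<iota> l i
      = (\<lambda>u. M #>\<^bsub>W\<^esub> u) ` wreath_summand \<Lambda> I C \<iota> l i"
    if l: "l \<in> \<Lambda> - \<Upsilon>" and i: "i \<in> I l" for l i
  proof -
    have "ext (rest.single l i c) = single l i c" if "c \<in> carrier (C l i)" for c
      using l i that
      by (intro D_eqI) (auto simp: ext_closed rest.single_closed single_closed)
    then show ?thesis
      using l i by (simp add: rest.wreath_summand_eq wreath_summand_eq image_image cong: image_cong)
  qed
  have summand_subset: "wreath_summand \<Lambda> I C \<iota> l i \<subseteq> carrier W" for l i
    unfolding wreath_summand_def by auto
  show ?thesis
  proof (intro untwisted_wreath_like_product.intro wreath_like_product.intro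
      untwisted_wreath_like_product_axioms.intro)
    show "group_extension rest.D (W Mod M) B ?\<iota> \<epsilon>'"
      unfolding group_extension_def mon_def epi_def
      using rest.group_D M.factorgroup_is_group B.is_group \<iota>'_hom \<iota>'_inj \<epsilon>'_hom \<epsilon>'_onto exact
      by blast
  next
    fix a l i assume a: "a \<in> carrier (W Mod M)" and l: "l \<in> \<Lambda> - \<Upsilon>" and i: "i \<in> I l"
    obtain w where w: "w \<in> carrier W" "a = M #>\<^bsub>W\<^esub> w"
      using a by (auto simp: carrier_FactGroup)
    have "a <#\<^bsub>W Mod M\<^esub> wreath_summand (\<Lambda> - \<Upsilon>) I C ?\<iota> l i #>\<^bsub>W Mod M\<^esub> inv\<^bsub>W Mod M\<^esub> a
        = (\<lambda>u. M #>\<^bsub>W\<^esub> u) ` (w <#\<^bsub>W\<^esub> wreath_summand \<Lambda> I C \<iota> l i #>\<^bsub>W\<^esub> inv\<^bsub>W\<^esub> w)"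
      unfolding summand[OF l i] w(2) by (rule \<rho>.image_conjugate[OF summand_subset w(1)])
    also have "\<dots> = (\<lambda>u. M #>\<^bsub>W\<^esub> u) ` wreath_summand \<Lambda> I C \<iota> l (act l w i)"
      using conjugation[OF w(1) _ i] l by simp
    also have "\<dots> = wreath_summand (\<Lambda> - \<Upsilon>) I C ?\<iota> l (\<phi> l (\<epsilon>' a) i)"
      using l i w by (simp add: summand act_closed \<epsilon>')
    finally show "a <#\<^bsub>W Mod M\<^esub> wreath_summand (\<Lambda> - \<Upsilon>) I C ?\<iota> l i #>\<^bsub>W Mod M\<^esub> inv\<^bsub>W Mod M\<^esub> a
        = wreath_summand (\<Lambda> - \<Upsilon>) I C ?\<iota> l (\<phi> l (\<epsilon>' a) i)" .
  next
    fix l i assume l: "l \<in> \<Lambda> - \<Upsilon>" and i: "i \<in> I l"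
    show "{a \<in> carrier (W Mod M). \<epsilon>' a \<in> stabilizer B (\<phi> l) i}
        \<subseteq> centralizer (W Mod M) (wreath_summand (\<Lambda> - \<Upsilon>) I C ?\<iota> l i)"
    proof
      fix a assume a: "a \<in> {a \<in> carrier (W Mod M). \<epsilon>' a \<in> stabilizer B (\<phi> l) i}"
      then obtain w where w: "w \<in> carrier W" "a = M #>\<^bsub>W\<^esub> w"
        by (auto simp: carrier_FactGroup)
      then have "w \<in> centralizer W (wreath_summand \<Lambda> I C \<iota> l i)"
        using a untwisted[of l i] l i by (auto simp: \<epsilon>')
      then show "a \<in> centralizer (W Mod M) (wreath_summand (\<Lambda> - \<Upsilon>) I C ?\<iota> l i)"
        unfolding summand[OF l i] w(2) by (rule \<rho>.image_centralizer[OF summand_subset])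
    qed
  qed (use group_A action group_C iso_C in simp_all)
qed

text \<open>
  Collects the invariant sums over all \<open>l \<in> \<Upsilon>\<close> into one homomorphism onto the direct sum of the
  groups \<open>A l\<close>.
\<close>

lemma invariant_total:
  assumes transitive: "\<And>l. l \<in> \<Upsilon> \<Longrightarrow> nonempty_transitive_action B (I l) (\<phi> l)"
  shows "\<exists>\<Phi>. \<Phi> \<in> hom D (sum_group \<Upsilon> A) \<and>
    \<Phi> ` {x \<in> carrier D. support x \<subseteq> \<Upsilon> \<times> UNIV} = carrier (sum_group \<Upsilon> A) \<and>
    (\<forall>w\<in>carrier W. \<forall>x\<in>carrier D. \<Phi> (conj w x) = \<Phi> x)"
proof -
  have "\<exists>S. S \<in> hom (sum_group (I l) (C l)) (A l) \<and>
      S ` carrier (sum_group (I l) (C l)) = carrier (A l) \<and>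
      (\<forall>w\<in>carrier W. \<forall>x\<in>carrier D. S (conj w x l) = S (x l))" if "l \<in> \<Upsilon>" for l
  proof -
    have l: "l \<in> \<Lambda>" using that \<Upsilon>_subset by blast
    show ?thesis
      by (rule invariant_sum[OF l transitive[OF that]]) (intro exI conjI ballI; assumption)
  qed
  then obtain S where S: "\<And>l. l \<in> \<Upsilon> \<Longrightarrow> S l \<in> hom (sum_group (I l) (C l)) (A l)"
    and S_onto: "\<And>l. l \<in> \<Upsilon> \<Longrightarrow> S l ` carrier (sum_group (I l) (C l)) = carrier (A l)"
    and S_conj: "\<And>l w x. \<lbrakk>l \<in> \<Upsilon>; w \<in> carrier W; x \<in> carrier D\<rbrakk> \<Longrightarrow> S l (conj w x l) = S l (x l)"
    by metis
  have A: "group (A l)" and SC: "group (sum_group (I l) (C l))" if "l \<in> \<Upsilon>" for l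
    using that \<Upsilon>_subset group_A group_sum_C by auto
  have S_one: "S l \<one>\<^bsub>sum_group (I l) (C l)\<^esub> = \<one>\<^bsub>A l\<^esub>" if "l \<in> \<Upsilon>" for l
    using hom_one[OF S SC A] that by blast
  define \<Phi> where "\<Phi> x = (\<lambda>l\<in>\<Upsilon>. S l (x l))" for x
  have component: "x l \<in> carrier (sum_group (I l) (C l))" if "x \<in> carrier D" "l \<in> \<Upsilon>" for x l
    using that \<Upsilon>_subset D_component by blast
  have closed: "\<Phi> x \<in> carrier (sum_group \<Upsilon> A)" if x: "x \<in> carrier D" for x
  proof -
    have "finite {l \<in> \<Lambda>. x l \<noteq> \<one>\<^bsub>sum_group (I l) (C l)\<^esub>}"
      using x unfolding double_sum_group_def by (simp add: carrier_sum_group group_sum_C)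
    moreover have "{l \<in> \<Upsilon>. S l (x l) \<noteq> \<one>\<^bsub>A l\<^esub>} \<subseteq> {l \<in> \<Lambda>. x l \<noteq> \<one>\<^bsub>sum_group (I l) (C l)\<^esub>}"
      using \<Upsilon>_subset S_one by auto
    ultimately have "finite {l \<in> \<Upsilon>. S l (x l) \<noteq> \<one>\<^bsub>A l\<^esub>}" by (rule finite_subset[rotated])
    moreover have "S l (x l) \<in> carrier (A l)" if "l \<in> \<Upsilon>" for l
      using hom_in_carrier[OF S component] x that by blast
    ultimately show ?thesis
      by (simp add: carrier_sum_group A \<Phi>_def cong: conj_cong)
  qed
  have hom: "\<Phi> \<in> hom D (sum_group \<Upsilon> A)"
  proof (rule homI)
    fix x y assume x: "x \<in> carrier D" and y: "y \<in> carrier D"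
    have "S l ((x \<otimes>\<^bsub>D\<^esub> y) l) = S l (x l) \<otimes>\<^bsub>A l\<^esub> S l (y l)" if l: "l \<in> \<Upsilon>" for l
    proof -
      have "(x \<otimes>\<^bsub>D\<^esub> y) l = x l \<otimes>\<^bsub>sum_group (I l) (C l)\<^esub> y l"
        using l \<Upsilon>_subset by (auto simp: D_mult)
      then show ?thesis
        using hom_mult[OF S[OF l] component[OF x l] component[OF y l]] by simp
    qed
    then show "\<Phi> (x \<otimes>\<^bsub>D\<^esub> y) = \<Phi> x \<otimes>\<^bsub>sum_group \<Upsilon> A\<^esub> \<Phi> y"
      by (auto simp: \<Phi>_def intro!: restrict_ext)
  qed (rule closed)
  have "a \<in> \<Phi> ` {x \<in> carrier D. support x \<subseteq> \<Upsilon> \<times> UNIV}" if a: "a \<in> carrier (sum_group \<Upsilon> A)" for a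
  proof -
    have a_l: "a l \<in> carrier (A l)" if "l \<in> \<Upsilon>" for l
      using a that by (auto simp: carrier_sum_group A)
    \<comment> \<open>Where \<open>a\<close> is trivial the preimage must be trivial too, to keep the support finite.\<close>
    have "\<exists>y\<in>carrier (sum_group (I l) (C l)). S l y = a l \<and>
        (a l = \<one>\<^bsub>A l\<^esub> \<longrightarrow> y = \<one>\<^bsub>sum_group (I l) (C l)\<^esub>)" if l: "l \<in> \<Upsilon>" for l
    proof (cases "a l = \<one>\<^bsub>A l\<^esub>")
      case True
      then show ?thesis
        using S_one[OF l] group.is_monoid[OF SC[OF l], THEN monoid.one_closed] by metis
    next
      case False
      then show ?thesis using a_l[OF l] S_onto[OF l] by (metis imageE)
    qed
    then obtain y where y: "\<And>l. l \<in> \<Upsilon> \<Longrightarrow> y l \<in> carrier (sum_group (I l) (C l))"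
      "\<And>l. l \<in> \<Upsilon> \<Longrightarrow> S l (y l) = a l"
      "\<And>l. \<lbrakk>l \<in> \<Upsilon>; a l = \<one>\<^bsub>A l\<^esub>\<rbrakk> \<Longrightarrow> y l = \<one>\<^bsub>sum_group (I l) (C l)\<^esub>"
      by metis
    define x where "x = (\<lambda>l\<in>\<Lambda>. if l \<in> \<Upsilon> then y l else \<one>\<^bsub>sum_group (I l) (C l)\<^esub>)"
    have "finite {l \<in> \<Upsilon>. a l \<noteq> \<one>\<^bsub>A l\<^esub>}" using a by (simp add: carrier_sum_group A)
    moreover have "{l \<in> \<Lambda>. x l \<noteq> \<one>\<^bsub>sum_group (I l) (C l)\<^esub>} \<subseteq> {l \<in> \<Upsilon>. a l \<noteq> \<one>\<^bsub>A l\<^esub>}"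
      using y(3) by (auto simp: x_def)
    ultimately have "finite {l \<in> \<Lambda>. x l \<noteq> \<one>\<^bsub>sum_group (I l) (C l)\<^esub>}" by (rule finite_subset[rotated])
    moreover have "x \<in> (\<Pi>\<^sub>E l\<in>\<Lambda>. carrier (sum_group (I l) (C l)))"
      using y(1) group.is_monoid[OF group_sum_C, THEN monoid.one_closed]
      by (simp only: x_def restrict_PiE_iff split: if_split) blast
    ultimately have "x \<in> carrier D"
      unfolding double_sum_group_def by (simp only: carrier_sum_group group_sum_C) blast
    moreover have "support x \<subseteq> \<Upsilon> \<times> UNIV"
      by (auto simp: support_def x_def split: if_splits)
    moreover have "\<Phi> x = a"
    proof
      fix l show "\<Phi> x l = a l"
        using y(2) \<Upsilon>_subset a by (auto simp: \<Phi>_def x_def carrier_sum_group A PiE_iff extensional_def)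
    qed
    ultimately show ?thesis by blast
  qed
  then have "\<Phi> ` {x \<in> carrier D. support x \<subseteq> \<Upsilon> \<times> UNIV} = carrier (sum_group \<Upsilon> A)"
    using closed by blast
  moreover have "\<Phi> (conj w x) = \<Phi> x" if "w \<in> carrier W" "x \<in> carrier D" for w x
    using that S_conj by (auto simp: \<Phi>_def intro!: restrict_ext)
  ultimately show ?thesis using hom by blast
qed

text \<open>
  The same homomorphism, now read on the subgroup \<open>M\<close> of \<open>W\<close> through the embedding of the base.
\<close>

lemma invariant_hom_on_M:
  assumes transitive: "\<And>l. l \<in> \<Upsilon> \<Longrightarrow> nonempty_transitive_action B (I l) (\<phi> l)"
  shows "\<exists>s. invariant_hom M W (sum_group \<Upsilon> A) s"
proof -
  let ?K = "{x \<in> carrier D. support x \<subseteq> \<Upsilon> \<times> UNIV}"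
  obtain \<Phi> where \<Phi>: "\<Phi> \<in> hom D (sum_group \<Upsilon> A)" and onto: "\<Phi> ` ?K = carrier (sum_group \<Upsilon> A)"
    and conj: "\<And>w x. \<lbrakk>w \<in> carrier W; x \<in> carrier D\<rbrakk> \<Longrightarrow> \<Phi> (conj w x) = \<Phi> x"
    using invariant_total[OF transitive] by blast
  define s where "s m = \<Phi> (inv_into (carrier D) \<iota> m)" for m
  have s: "s (\<iota> x) = \<Phi> x" if "x \<in> carrier D" for x
    using that \<iota>_inj by (simp add: s_def)
  have "invariant_hom_axioms M W (sum_group \<Upsilon> A) s"
  proof
    show "s \<in> hom (W\<lparr>carrier := M\<rparr>) (sum_group \<Upsilon> A)"
    proof (rule homI)
      fix m n assume "m \<in> carrier (W\<lparr>carrier := M\<rparr>)" "n \<in> carrier (W\<lparr>carrier := M\<rparr>)"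
      then obtain x y where "x \<in> carrier D" "m = \<iota> x" "y \<in> carrier D" "n = \<iota> y"
        unfolding M_def by auto
      then show "s m \<in> carrier (sum_group \<Upsilon> A)"
        and "s (m \<otimes>\<^bsub>W\<lparr>carrier := M\<rparr>\<^esub> n) = s m \<otimes>\<^bsub>sum_group \<Upsilon> A\<^esub> s n"
        using hom_in_carrier[OF \<Phi>] hom_mult[OF \<Phi>] by (simp_all add: s flip: \<iota>.hom_mult)
    qed
    show "s ` M = carrier (sum_group \<Upsilon> A)"
      unfolding M_def onto[symmetric] image_image by (rule image_cong) (auto simp: s)
    fix g m assume g: "g \<in> carrier W" and "m \<in> M"
    then obtain x where x: "x \<in> carrier D" "m = \<iota> x" unfolding M_def by blast
    show "s (g \<otimes>\<^bsub>W\<^esub> m \<otimes>\<^bsub>W\<^esub> inv\<^bsub>W\<^esub> g) = s m"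
      using g x by (simp add: s conj_closed conj flip: \<iota>_conj)
  qed
  moreover have "group (sum_group \<Upsilon> A)"
    using \<Upsilon>_subset group_A by (intro sum_group) blast
  ultimately show ?thesis
    using M_normal by (blast intro: invariant_hom.intro)
qed

end

section \<open>The central extension\<close>

theorem theorem3p12:
  fixes \<Lambda> \<Upsilon> :: "'l set"
    and A :: "'l \<Rightarrow> 'a monoid"
    and B :: "'b monoid"
    and I :: "'l \<Rightarrow> 'i set"
    and \<phi> :: "'l \<Rightarrow> 'b \<Rightarrow> 'i \<Rightarrow> 'i"
    and U :: "'u monoid"
    and C :: "'l \<Rightarrow> 'i \<Rightarrow> 'c monoid"
    and \<iota> :: "('l \<Rightarrow> 'i \<Rightarrow> 'c) \<Rightarrow> 'u"
    and \<epsilon> :: "'u \<Rightarrow> 'b"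
  assumes "finite \<Upsilon>" and "\<Upsilon> \<subseteq> \<Lambda>"
    and "group B"
    and "\<And>l. l \<in> \<Lambda> \<Longrightarrow> group (A l)"
    and "\<And>l. l \<in> \<Lambda> \<Longrightarrow> nonempty_transitive_action B (I l) (\<phi> l)"
    and "\<And>l i. \<lbrakk>l \<in> \<Lambda>; i \<in> I l\<rbrakk> \<Longrightarrow> finite (stabilizer B (\<phi> l) i)"
    and "untwisted_wreath_like_product \<Lambda> A B I \<phi> U C \<iota> \<epsilon>"
    and "\<And>l. l \<in> \<Upsilon> \<Longrightarrow>
           A l \<cong> integer_group \<or> (comm_group (A l) \<and> regular_action B (I l) (\<phi> l))"
  shows "\<exists>(Q :: 'u set monoid) (W :: 'u set monoid)
            (C' :: 'l \<Rightarrow> 'i \<Rightarrow> 'c monoid) (\<iota>' :: ('l \<Rightarrow> 'i \<Rightarrow> 'c) \<Rightarrow> 'u set) (\<epsilon>' :: 'u set \<Rightarrow> 'b)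
            (\<pi> :: 'u \<Rightarrow> 'u set) (j :: ('l \<Rightarrow> 'a) \<Rightarrow> 'u set) (q :: 'u set \<Rightarrow> 'u set).
          \<pi> \<in> epi U Q \<and>
          central_extension (sum_group \<Upsilon> A) Q W j q \<and>
          untwisted_wreath_like_product (\<Lambda> - \<Upsilon>) A B I \<phi> W C' \<iota>' \<epsilon>' \<and>
          (\<exists>\<sigma>. set_section Q W q \<sigma> \<and>
               cocycle_trivial_on (sum_group \<Upsilon> A)
                 (extension_cocycle (sum_group \<Upsilon> A) Q W j \<sigma>)
                 (wreath_base (\<Lambda> - \<Upsilon>) I C' \<iota>'))"
proof -
  interpret wreath_quotient \<Lambda> A B I \<phi> U C \<iota> \<epsilon> \<Upsilon>
    by (intro wreath_quotient.intro wreath_quotient_axioms.intro assms)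
  obtain s where "invariant_hom M U (sum_group \<Upsilon> A) s"
    using invariant_hom_on_M assms(2,5) by blast
  then interpret s: invariant_hom M U "sum_group \<Upsilon> A" s .
  interpret N: normal s.N U by (rule s.N_normal)
  obtain j q where central: "central_extension (sum_group \<Upsilon> A) (U Mod s.N) (U Mod M) j q"
    and q: "\<And>x. x \<in> carrier U \<Longrightarrow> q (s.N #>\<^bsub>U\<^esub> x) = M #>\<^bsub>U\<^esub> x"
    using s.central_extension_of_quotients by blast
  have "\<epsilon> x = \<epsilon> y" if "x \<in> carrier U" "y \<in> carrier U" "M #>\<^bsub>U\<^esub> x = M #>\<^bsub>U\<^esub> y" for x y
  proof -
    have "x \<otimes>\<^bsub>U\<^esub> inv\<^bsub>U\<^esub> y \<in> M" using that by (simp add: M.rcos_eq_iff[OF W.is_group])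
    then have "\<epsilon> (x \<otimes>\<^bsub>U\<^esub> inv\<^bsub>U\<^esub> y) = \<one>\<^bsub>B\<^esub>" unfolding M_def using \<epsilon>_\<iota> by auto
    then show ?thesis
      using that by (simp add: B.inv_solve_right')
  qed
  then obtain \<epsilon>' where "\<epsilon>' \<in> hom (U Mod M) B"
    and "\<And>w. w \<in> carrier U \<Longrightarrow> \<epsilon>' (M #>\<^bsub>U\<^esub> w) = \<epsilon> w"
    using FactGroup_universal[OF \<epsilon>.homh M_normal] by metis
  then have "untwisted_wreath_like_product (\<Lambda> - \<Upsilon>) A B I \<phi> (U Mod M) C (\<lambda>y. M #>\<^bsub>U\<^esub> \<iota> (ext y)) \<epsilon>'"
    by (rule untwisted_quotient)
  moreover have "(\<lambda>x. s.N #>\<^bsub>U\<^esub> x) \<in> epi U (U Mod s.N)"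
    by (simp add: epi_def N.r_coset_hom_Mod carrier_FactGroup)
  moreover obtain \<sigma> where "set_section (U Mod s.N) (U Mod M) q \<sigma>"
    and "cocycle_trivial_on (sum_group \<Upsilon> A)
      (extension_cocycle (sum_group \<Upsilon> A) (U Mod s.N) (U Mod M) j \<sigma>) ((\<lambda>x. M #>\<^bsub>U\<^esub> x) ` L)"
    using s.section_trivial_on_complement[OF _ q L_subgroup L_Int_M] central
    unfolding central_extension_def by blast
  moreover have "(\<lambda>x. M #>\<^bsub>U\<^esub> x) ` L = wreath_base (\<Lambda> - \<Upsilon>) I C (\<lambda>y. M #>\<^bsub>U\<^esub> \<iota> (ext y))"
    unfolding L_def wreath_base_def image_image ..
  ultimately show ?thesis using central by metis
qed

end
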